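(* Let $k$ be an algebraically closed field of characteristic $p>0$, let $n\ge 1$, let $G=\mathbb{Z}/p^{n}\mathbb{Z}$, and let $V$ be an effective $G$-representation over $k$ of dimension $d$. The integral $\int_{G\text{-}\mathrm{Cov}(D)}\mathbb{L}^{d-\boldsymbol{v}_V}$ converges if and only if the strict inequalities $$1-\frac{1}{p^{n-m}}-\sum_{l=m}^{n-1}\frac{D_V^{(l)}}{p^{2n-1-l}}<0\qquad(m=0,1,\dots,n-1)$$ hold. If the inequalities $$1-\frac{1}{p^{n-m}}-\sum_{l=m}^{n-1}\frac{D_V^{(l)}}{p^{2n-1-l}}\le 0\qquad(m=0,1,\dots,n-1)$$ hold, then the integral $\int_{G\text{-}\mathrm{Cov}(D)}\mathbb{L}^{d-\boldsymbol{v}_V}$ has terms of dimension bounded above.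
   Context: Representations are finite-dimensional over $k$; effective means $G\to GL(V)$ is injective. For each $1\le d\le p^n$ there is, up to isomorphism, exactly one indecomposable $G$-representation of dimension $d$ (a generator acts by a single unipotent Jordan block), and every $G$-representation is a direct sum of indecomposables. Invariants. For a positive integer $d\le p^n$ and $0\le m\le n-1$, let $$S_d^{(m)}=\sum_{\substack{0\le i_0+i_1p+\dots+i_{n-1}p^{n-1}<d\\ 0\le i_0,\dots,i_{n-1}<p}} i_m .$$ For $V$ indecomposable of dimension $d$, let $$D_V^{(m)}=p^{n-1}\Big(S_d^{(m)}-(p-1)\sum_{l=m+1}^{n-1}p^{m-l}S_d^{(l)}\Big)\quad(0\le m\le n-1),$$ and extend $D_V^{(m)}$ additively to direct sums. $G$-covers. Let $K=k((t))$ and $D=\operatorname{Spec}k[[t]]$. A $G$-cover of $D$ is the normalization of $D$ in an étale $G$-cover of $\operatorname{Spec}K$; $G\text{-}\mathrm{Cov}(D)$ is the moduli space of $G$-covers of $D$. By Artin–Schreier–Witt theory, $G$-covers correspond bijectively to reduced Witt vectors $\boldsymbol f=(f_0,\dots,f_{n-1})$, i.e. each $f_m$ is of the form $\sum_{j>0,\,p\nmid j}a_{m,j}t^{-j}\in k[t^{-1}]$ (finite sum); the cover is defined by $\wp(\boldsymbol g)=\boldsymbol f$, $\wp=\text{Frobenius}-\mathrm{id}$. For $\boldsymbol j=(j_0,\dots,j_{n-1})$ with each $j_m$ either a positive integer prime to $p$ or $-\infty$, $G\text{-}\mathrm{Cov}(D;\boldsymbol j)$ is the set of covers with $\operatorname{ord}f_m=-j_m$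 for all $m$ ($j_m=-\infty$ means $f_m=0$). It is identified with $\prod_{j_m\ne-\infty}\mathbb{G}_{m,k}\times_k\mathbb{A}_k^{\,j_m-1-\lfloor j_m/p\rfloor}$, so it has dimension $\sum_{j_m\neq-\infty}(j_m-\lfloor j_m/p\rfloor)$, and $G\text{-}\mathrm{Cov}(D)=\coprod_{\boldsymbol j}G\text{-}\mathrm{Cov}(D;\boldsymbol j)$. A cover is connected iff $j_0\neq-\infty$. The $\boldsymbol v$-function $\boldsymbol v_V$ on $G\text{-}\mathrm{Cov}(D)$ is constant on each stratum and additive in $V$. For $V$ indecomposable of dimension $d$ and $E\in G\text{-}\mathrm{Cov}(D;\boldsymbol j)$ connected, put $u_i=\max\{p^{i-m}j_m\mid 0\le m\le i\}$ and $l_i=u_0+(u_1-u_0)p+\dots+(u_i-u_{i-1})p^i$ (the upper and lower ramification jumps); then $$\boldsymbol v_V(E)=\sum_{\substack{0\le i_0+i_1p+\dots+i_{n-1}p^{n-1}<d\\0\le i_0,\dots,i_{n-1}<p}}\left\lceil\frac{i_0p^{n-1}l_0+i_1p^{n-2}l_1+\dots+i_{n-1}l_{n-1}}{p^n}\right\rceil .$$ If $E$ is not connected, with connected component $E'$ having stabilizer $G'\subset G$, then $\boldsymbol v_V(E)=\boldsymbol v_{V'}(E')$, where $V'=V|_{G'}$ and $E'$ is regarded as a $G'$-cover (if $j_0=\dots=j_{r-1}=-\infty\ne j_r$, then $G'$ has order $p^{n-r}$ and $E'$ corresponds to $(f_r,\dots,f_{n-1})$; the trivial cover has value $0$). Integral.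 With $\mathbb L=[\mathbb A^1_k]$, $$\int_{G\text{-}\mathrm{Cov}(D)}\mathbb L^{d-\boldsymbol v_V}=\sum_{\boldsymbol j}[G\text{-}\mathrm{Cov}(D;\boldsymbol j)]\,\mathbb L^{d-\boldsymbol v_V|_{G\text{-}\mathrm{Cov}(D;\boldsymbol j)}}$$ in the Grothendieck ring of varieties (a version of it) completed with respect to dimension. It converges if the dimensions of the terms tend to $-\infty$: for every integer $N$ only finitely many $\boldsymbol j$ satisfy $\dim G\text{-}\mathrm{Cov}(D;\boldsymbol j)+d-\boldsymbol v_V|_{G\text{-}\mathrm{Cov}(D;\boldsymbol j)}>N$. It "has terms of dimension bounded above" if there is a constant $C$ with $\dim G\text{-}\mathrm{Cov}(D;\boldsymbol j)+d-\boldsymbol v_V|_{G\text{-}\mathrm{Cov}(D;\boldsymbol j)}\le C$ for all $\boldsymbol j$. *)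

theory Defs
  imports
    Main
    "HOL-Library.Multiset"
    "HOL-Library.FuncSet"
    "HOL-Computational_Algebra.Computational_Algebra"
    "HOL-Algebra.Elementary_Groups"
begin

text \<open>A \<open>k\<close>-vector space is given by its scalar multiplication \<open>scale\<close> on the whole type \<open>'v\<close>.
  The cyclic group of order \<open>N\<close> is \<^const>\<open>integer_mod_group\<close> \<open>N\<close>, with carrier \<open>{0..<N}\<close>
  for \<open>N > 0\<close>.\<close>

definition general_linear_group ::
    "('k::field \<Rightarrow> 'v::ab_group_add \<Rightarrow> 'v) \<Rightarrow> ('v \<Rightarrow> 'v) monoid" where
  "general_linear_group scale =
     \<lparr>carrier = {f. Vector_Spaces.linear scale scale f \<and> bij f}, monoid.mult = (\<circ>), one = id\<rparr>"

definition cyclic_rep ::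
    "nat \<Rightarrow> ('k::field \<Rightarrow> 'v::ab_group_add \<Rightarrow> 'v) \<Rightarrow> (int \<Rightarrow> 'v \<Rightarrow> 'v) \<Rightarrow> bool" where
  "cyclic_rep N scale \<rho> \<longleftrightarrow> \<rho> \<in> hom (integer_mod_group N) (general_linear_group scale)"

definition effective_rep :: "nat \<Rightarrow> (int \<Rightarrow> 'v \<Rightarrow> 'v) \<Rightarrow> bool" where
  "effective_rep N \<rho> \<longleftrightarrow> inj_on \<rho> (carrier (integer_mod_group N))"

definition subrep ::
    "nat \<Rightarrow> ('k::field \<Rightarrow> 'v::ab_group_add \<Rightarrow> 'v) \<Rightarrow> (int \<Rightarrow> 'v \<Rightarrow> 'v) \<Rightarrow> 'v set \<Rightarrow> bool" where
  "subrep N scale \<rho> W \<longleftrightarrow>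
     module.subspace scale W \<and> (\<forall>g\<in>carrier (integer_mod_group N). \<rho> g ` W \<subseteq> W)"

definition indecomposable_subrep ::
    "nat \<Rightarrow> ('k::field \<Rightarrow> 'v::ab_group_add \<Rightarrow> 'v) \<Rightarrow> (int \<Rightarrow> 'v \<Rightarrow> 'v) \<Rightarrow> 'v set \<Rightarrow> bool" where
  "indecomposable_subrep N scale \<rho> W \<longleftrightarrow>
     subrep N scale \<rho> W \<and> W \<noteq> {0} \<and>
     (\<forall>A B. subrep N scale \<rho> A \<and> subrep N scale \<rho> B \<and>
            A \<inter> B = {0} \<and> {a + b | a b. a \<in> A \<and> b \<in> B} = W
            \<longrightarrow> A = {0} \<or> B = {0})"

text \<open>\<open>\<W>\<close> is the set of summands of an internal direct sum decomposition of the whole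
  representation into indecomposables.  A set suffices, since nonzero subspaces whose sum is
  direct are distinct.\<close>

definition indecomposable_decomposition ::
    "nat \<Rightarrow> ('k::field \<Rightarrow> 'v::ab_group_add \<Rightarrow> 'v) \<Rightarrow> (int \<Rightarrow> 'v \<Rightarrow> 'v) \<Rightarrow> 'v set set \<Rightarrow> bool" where
  "indecomposable_decomposition N scale \<rho> \<W> \<longleftrightarrow>
     finite \<W> \<and> (\<forall>W\<in>\<W>. indecomposable_subrep N scale \<rho> W) \<and>
     (\<forall>v. \<exists>!w. w \<in> (\<Pi>\<^sub>E W\<in>\<W>. W) \<and> v = (\<Sum>W\<in>\<W>. w W))"

text \<open>The description operator is justified by the Krull--Schmidt theorem.\<close>

definition indecomposable_dims ::
    "nat \<Rightarrow> ('k::field \<Rightarrow> 'v::ab_group_add \<Rightarrow> 'v) \<Rightarrow> (int \<Rightarrow> 'v \<Rightarrow> 'v) \<Rightarrow> nat multiset" where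
  "indecomposable_dims N scale \<rho> =
     (THE M. \<exists>\<W>. indecomposable_decomposition N scale \<rho> \<W> \<and>
                 M = image_mset (vector_space.dim scale) (mset_set \<W>))"

text \<open>Restriction of a representation of the cyclic group of order \<open>p ^ n\<close> to its subgroup of
  order \<open>p ^ (n - r)\<close>, which is identified with \<^const>\<open>integer_mod_group\<close> \<open>(p ^ (n - r))\<close>
  through its generator \<open>p ^ r\<close>.\<close>

definition restrict_rep :: "nat \<Rightarrow> nat \<Rightarrow> (int \<Rightarrow> 'v \<Rightarrow> 'v) \<Rightarrow> int \<Rightarrow> 'v \<Rightarrow> 'v" where
  "restrict_rep p r \<rho> x = \<rho> (int p ^ r * x)"

definition digit_tuples :: "nat \<Rightarrow> nat \<Rightarrow> nat \<Rightarrow> (nat \<Rightarrow> nat) set" where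
  "digit_tuples p n d = {i \<in> {..<n} \<rightarrow>\<^sub>E {..<p}. (\<Sum>m<n. i m * p ^ m) < d}"

definition S_inv :: "nat \<Rightarrow> nat \<Rightarrow> nat \<Rightarrow> nat \<Rightarrow> nat" where
  "S_inv p n d m = (\<Sum>i\<in>digit_tuples p n d. i m)"

definition D_indec :: "nat \<Rightarrow> nat \<Rightarrow> nat \<Rightarrow> nat \<Rightarrow> real" where
  "D_indec p n d m = real p ^ (n - 1) *
     (real (S_inv p n d m)
      - (real p - 1) * (\<Sum>l=m+1..n-1. real p powi (int m - int l) * real (S_inv p n d l)))"

definition D_inv ::
    "nat \<Rightarrow> nat \<Rightarrow> ('k::field \<Rightarrow> 'v::ab_group_add \<Rightarrow> 'v) \<Rightarrow> (int \<Rightarrow> 'v \<Rightarrow> 'v) \<Rightarrow> nat \<Rightarrow> real" where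
  "D_inv p n scale \<rho> m =
     (\<Sum>d\<in>#indecomposable_dims (p ^ n) scale \<rho>. D_indec p n d m)"

text \<open>By Artin--Schreier--Witt theory, the covers of the formal disk for the cyclic group of order
  \<open>p ^ n\<close> are the reduced Witt vectors of length \<open>n\<close> over \<open>k((t))\<close>.  They are represented by lists
  of length \<open>n\<close> of formal Laurent series, each of them a finite sum of terms \<open>a * t ^ (-j)\<close> with
  \<open>j > 0\<close> prime to \<open>p\<close>.\<close>

definition reduced_fls :: "nat \<Rightarrow> 'k::field fls \<Rightarrow> bool" where
  "reduced_fls p f \<longleftrightarrow> (\<forall>i. fls_nth f i \<noteq> 0 \<longrightarrow> i < 0 \<and> \<not> int p dvd i)"

text \<open>The index \<open>None\<close> stands for \<open>-\<infinity>\<close>.\<close>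

definition strata_indices :: "nat \<Rightarrow> nat \<Rightarrow> nat option list set" where
  "strata_indices p n =
     {js. length js = n \<and> (\<forall>j. Some j \<in> set js \<longrightarrow> 0 < j \<and> \<not> p dvd j)}"

definition GCov_stratum :: "nat \<Rightarrow> nat option list \<Rightarrow> 'k::field fls list set" where
  "GCov_stratum p js =
     {fs. length fs = length js \<and>
          (\<forall>m<length js. reduced_fls p (fs ! m) \<and>
             (case js ! m of
                None \<Rightarrow> fs ! m = 0
              | Some j \<Rightarrow> fs ! m \<noteq> 0 \<and> fls_subdegree (fs ! m) = - int j))}"

text \<open>A component with leading exponent \<open>-j\<close> contributes a factor
  \<open>\<G>\<^sub>m \<times> \<A>\<^bsup>j - 1 - \<lfloor>j / p\<rfloor>\<^esup>\<close> to the stratum: the leading coefficient is nonzero, and the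
  coefficients of \<open>t ^ (-i)\<close> for the \<open>i < j\<close> prime to \<open>p\<close> are arbitrary.\<close>

definition stratum_dim :: "nat \<Rightarrow> nat option list \<Rightarrow> int" where
  "stratum_dim p js =
     (\<Sum>m<length js. case js ! m of None \<Rightarrow> 0 | Some j \<Rightarrow> int j - int (j div p))"

text \<open>For a connected cover, i.e. \<open>fs ! 0 \<noteq> 0\<close>, the maximum defining the \<open>i\<close>-th upper jump is
  attained at a nonzero component, so components with \<open>j\<^sub>m = -\<infinity>\<close> are omitted.\<close>

definition upper_jump :: "nat \<Rightarrow> 'k::field fls list \<Rightarrow> nat \<Rightarrow> int" where
  "upper_jump p fs i =
     Max {int p ^ (i - m) * (- fls_subdegree (fs ! m)) | m. m \<le> i \<and> fs ! m \<noteq> 0}"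

definition lower_jump :: "nat \<Rightarrow> 'k::field fls list \<Rightarrow> nat \<Rightarrow> int" where
  "lower_jump p fs i =
     upper_jump p fs 0 + (\<Sum>a=1..i. (upper_jump p fs a - upper_jump p fs (a - 1)) * int p ^ a)"

definition v_indec :: "nat \<Rightarrow> nat \<Rightarrow> nat \<Rightarrow> 'k::field fls list \<Rightarrow> int" where
  "v_indec p n d fs =
     (\<Sum>i\<in>digit_tuples p n d.
        \<lceil>real_of_int (\<Sum>m<n. int (i m) * int p ^ (n - 1 - m) * lower_jump p fs m) / real p ^ n\<rceil>)"

definition v_connected ::
    "nat \<Rightarrow> nat \<Rightarrow> ('k::field \<Rightarrow> 'v::ab_group_add \<Rightarrow> 'v) \<Rightarrow> (int \<Rightarrow> 'v \<Rightarrow> 'v) \<Rightarrow>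
     'k fls list \<Rightarrow> int" where
  "v_connected p n scale \<rho> fs =
     (\<Sum>d\<in>#indecomposable_dims (p ^ n) scale \<rho>. v_indec p n d fs)"

text \<open>If \<open>r < n\<close> is minimal with \<open>fs ! r \<noteq> 0\<close>, then a connected component of the cover has a
  stabilizer of order \<open>p ^ (n - r)\<close> and corresponds to the Witt vector \<open>drop r fs\<close>.
  The case \<open>r = 0\<close> is that of a connected cover, and \<open>r = n\<close> that of the trivial cover.\<close>

definition v_fun ::
    "nat \<Rightarrow> nat \<Rightarrow> ('k::field \<Rightarrow> 'v::ab_group_add \<Rightarrow> 'v) \<Rightarrow> (int \<Rightarrow> 'v \<Rightarrow> 'v) \<Rightarrow>
     'k fls list \<Rightarrow> int" where
  "v_fun p n scale \<rho> fs =
     (let r = length (takeWhile (\<lambda>f. f = 0) fs) in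
      if r = n then 0
      else v_connected p (n - r) scale (restrict_rep p r \<rho>) (drop r fs))"

text \<open>The integral of \<open>\<L> ^ (d - v\<^sub>V)\<close> is the sum over the strata of the classes
  \<open>[G-Cov(D;j)] * \<L> ^ (d - v\<^sub>V)\<close>; convergence refers to the filtration by dimension.  The
  strata are nonempty and \<open>v\<^sub>V\<close> is constant on each of them, so it does not matter which
  cover \<open>E\<close> in the stratum is used to evaluate it.\<close>

definition term_dim ::
    "nat \<Rightarrow> nat \<Rightarrow> ('k::field \<Rightarrow> 'v::ab_group_add \<Rightarrow> 'v) \<Rightarrow> (int \<Rightarrow> 'v \<Rightarrow> 'v) \<Rightarrow>
     nat option list \<Rightarrow> 'k fls list \<Rightarrow> int" where
  "term_dim p n scale \<rho> js E =
     stratum_dim p js + int (vector_space.dim scale (UNIV :: 'v set)) - v_fun p n scale \<rho> E"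

definition integral_converges ::
    "nat \<Rightarrow> nat \<Rightarrow> ('k::field \<Rightarrow> 'v::ab_group_add \<Rightarrow> 'v) \<Rightarrow> (int \<Rightarrow> 'v \<Rightarrow> 'v) \<Rightarrow> bool" where
  "integral_converges p n scale \<rho> \<longleftrightarrow>
     (\<forall>N. finite {js \<in> strata_indices p n.
                    \<exists>E\<in>GCov_stratum p js. term_dim p n scale \<rho> js E > N})"

definition integral_terms_bounded ::
    "nat \<Rightarrow> nat \<Rightarrow> ('k::field \<Rightarrow> 'v::ab_group_add \<Rightarrow> 'v) \<Rightarrow> (int \<Rightarrow> 'v \<Rightarrow> 'v) \<Rightarrow> bool" where
  "integral_terms_bounded p n scale \<rho> \<longleftrightarrow>
     (\<exists>C. \<forall>js\<in>strata_indices p n. \<forall>E\<in>GCov_stratum p js. term_dim p n scale \<rho> js E \<le> C)"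

end

theory Submission
  imports Defs
begin

text \<open>If \<open>N = \<rho>(1) - 1\<close> then \<open>N ^ (p ^ n) = \<rho>(1) ^ (p ^ n) - 1 = 0\<close> in characteristic \<open>p\<close>, the
  indecomposable summands are the Jordan blocks of \<open>N\<close>, and their dimensions are determined by
  the ranks of the powers of \<open>N\<close>.  The subgroup generated by \<open>p ^ r\<close> acts through
  \<open>N ^ (p ^ r)\<close>, so a block of dimension \<open>d\<close> restricts to blocks whose dimensions count the
  numbers below \<open>d\<close> in the residue classes modulo \<open>p ^ r\<close>.  Hence the formula for \<open>v\<^sub>V\<close> on
  connected covers is valid on all strata, once \<open>j\<^sub>m = -\<infinity>\<close> is replaced by \<open>j\<^sub>m = 0\<close>.

  Up to a bounded error, the dimension of a term is then
  \<open>\<Sum>m. (1 - 1 / p) * j\<^sub>m - u\<^sub>m * D\<^sub>m / p ^ n\<close>, where \<open>u\<close> is the least sequence with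
  \<open>u\<^sub>m \<ge> j\<^sub>m\<close> and \<open>u\<^sub>m \<ge> p * u\<^bsub>m-1\<^esub>\<close>.  It is at most the value obtained for \<open>j = u\<close>, which is a linear
  function of \<open>u\<close>, and the cone of such \<open>u\<close> is spanned by the rays
  \<open>(0, \<dots>, 0, 1, p, p\<^sup>2, \<dots>)\<close>; the stated inequalities say that this function is
  negative on the rays.  The exponents \<open>j, p * j - 1, p\<^sup>2 * j - 1, \<dots>\<close> approximate the rays
  within the indices prime to \<open>p\<close>, which shows that the conditions are necessary.\<close>

section \<open>Nilpotent operators and indecomposable representations\<close>

context finite_dimensional_vector_space
begin

section \<open>Independent families of subspaces and their sums\<close>

text \<open>Families are indexed rather than sets of subspaces: the images of distinct summands
  under a power of \<open>N\<close> may coincide (both may be zero), and the index keeps them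
  apart.\<close>

definition indep_family :: "'i set \<Rightarrow> ('i \<Rightarrow> 'b set) \<Rightarrow> bool" where
  "indep_family I X \<longleftrightarrow>
     (\<forall>x. (\<forall>i\<in>I. x i \<in> X i) \<and> (\<Sum>i\<in>I. x i) = 0 \<longrightarrow> (\<forall>i\<in>I. x i = 0))"

definition family_sum :: "'i set \<Rightarrow> ('i \<Rightarrow> 'b set) \<Rightarrow> 'b set" where
  "family_sum I X = {\<Sum>i\<in>I. x i | x. \<forall>i\<in>I. x i \<in> X i}"

lemma indep_familyD:
  "indep_family I X \<Longrightarrow> (\<And>i. i \<in> I \<Longrightarrow> x i \<in> X i) \<Longrightarrow> (\<Sum>i\<in>I. x i) = 0 \<Longrightarrow> i \<in> I \<Longrightarrow> x i = 0"
  unfolding indep_family_def by blast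

lemma family_sumI: "(\<And>i. i \<in> I \<Longrightarrow> x i \<in> X i) \<Longrightarrow> (\<Sum>i\<in>I. x i) \<in> family_sum I X"
  unfolding family_sum_def by blast

lemma family_sumE:
  assumes "v \<in> family_sum I X"
  obtains x where "\<And>i. i \<in> I \<Longrightarrow> x i \<in> X i" "v = (\<Sum>i\<in>I. x i)"
  using assms unfolding family_sum_def by blast

lemma family_sum_empty [simp]: "family_sum {} X = {0}"
  unfolding family_sum_def by simp

lemma family_sum_singleton [simp]: "family_sum {i} X = X i"
  unfolding family_sum_def by (auto intro: exI[of _ "\<lambda>_. _"])

lemma family_sum_union:
  assumes "finite I" "finite J" "I \<inter> J = {}"
  shows "family_sum (I \<union> J) X = {a + b | a b. a \<in> family_sum I X \<and> b \<in> family_sum J X}"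
proof (intro equalityI subsetI)
  fix v assume "v \<in> family_sum (I \<union> J) X"
  then obtain x where x: "\<And>i. i \<in> I \<union> J \<Longrightarrow> x i \<in> X i" "v = (\<Sum>i\<in>I \<union> J. x i)"
    by (rule family_sumE) blast
  then have "v = (\<Sum>i\<in>I. x i) + (\<Sum>i\<in>J. x i)"
    using assms by (simp add: sum.union_disjoint)
  moreover have "(\<Sum>i\<in>I. x i) \<in> family_sum I X" "(\<Sum>i\<in>J. x i) \<in> family_sum J X"
    using x(1) by (auto intro: family_sumI)
  ultimately show "v \<in> {a + b | a b. a \<in> family_sum I X \<and> b \<in> family_sum J X}" by blast
next
  fix v assume "v \<in> {a + b | a b. a \<in> family_sum I X \<and> b \<in> family_sum J X}"
  then obtain a b where v: "v = a + b" "a \<in> family_sum I X" "b \<in> family_sum J X" by blast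
  obtain x where x: "\<And>i. i \<in> I \<Longrightarrow> x i \<in> X i" "a = (\<Sum>i\<in>I. x i)"
    using v(2) by (rule family_sumE) blast
  obtain y where y: "\<And>i. i \<in> J \<Longrightarrow> y i \<in> X i" "b = (\<Sum>i\<in>J. y i)"
    using v(3) by (rule family_sumE) blast
  let ?z = "\<lambda>i. if i \<in> I then x i else y i"
  have "(\<Sum>i\<in>I \<union> J. ?z i) = (\<Sum>i\<in>I. ?z i) + (\<Sum>i\<in>J. ?z i)"
    using assms by (simp add: sum.union_disjoint)
  also have "(\<Sum>i\<in>J. ?z i) = b"
    unfolding y(2) using assms(3) by (intro sum.cong) auto
  also have "(\<Sum>i\<in>I. ?z i) = a"
    unfolding x(2) by (intro sum.cong) auto
  finally have "v = (\<Sum>i\<in>I \<union> J. ?z i)" using v(1) by simp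
  moreover have "(\<Sum>i\<in>I \<union> J. ?z i) \<in> family_sum (I \<union> J) X"
    using x(1) y(1) by (intro family_sumI) auto
  ultimately show "v \<in> family_sum (I \<union> J) X" by simp
qed

lemma family_sum_insert:
  assumes "finite I" "i \<notin> I"
  shows "family_sum (insert i I) X = {a + b | a b. a \<in> X i \<and> b \<in> family_sum I X}"
  using family_sum_union[of "{i}" I X] assms by simp

lemma indep_family_union:
  assumes "finite I" "finite J" "I \<inter> J = {}"
    and "indep_family I X" "indep_family J X"
    and "family_sum I X \<inter> family_sum J X \<subseteq> {0}"
    and sub: "subspace (family_sum J X)"
  shows "indep_family (I \<union> J) X"
  unfolding indep_family_def
proof (intro allI impI)
  fix x assume x: "(\<forall>i\<in>I \<union> J. x i \<in> X i) \<and> (\<Sum>i\<in>I \<union> J. x i) = 0"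
  then have s: "(\<Sum>i\<in>I. x i) + (\<Sum>i\<in>J. x i) = 0"
    using assms by (simp add: sum.union_disjoint)
  have "(\<Sum>i\<in>I. x i) \<in> family_sum I X" "(\<Sum>i\<in>J. x i) \<in> family_sum J X"
    using x by (auto intro: family_sumI)
  moreover have "(\<Sum>i\<in>I. x i) = - (\<Sum>i\<in>J. x i)" using s by (simp add: eq_neg_iff_add_eq_0)
  ultimately have "(\<Sum>i\<in>I. x i) = 0"
    using assms(6) subspace_neg[OF sub] by (metis IntI singletonD subsetD)
  with s have "(\<Sum>i\<in>I. x i) = 0" "(\<Sum>i\<in>J. x i) = 0" by simp_all
  then have "\<forall>i\<in>I. x i = 0" "\<forall>i\<in>J. x i = 0"
    using x assms(4,5) unfolding indep_family_def by blast+
  then show "\<forall>i\<in>I \<union> J. x i = 0" by blast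
qed

lemma indep_family_subset:
  assumes "indep_family I X" "J \<subseteq> I" "finite I" "\<And>i. i \<in> I \<Longrightarrow> 0 \<in> X i"
  shows "indep_family J X"
  unfolding indep_family_def
proof (intro allI impI)
  fix x assume x: "(\<forall>i\<in>J. x i \<in> X i) \<and> (\<Sum>i\<in>J. x i) = 0"
  let ?y = "\<lambda>i. if i \<in> J then x i else 0"
  have "(\<Sum>i\<in>I. ?y i) = (\<Sum>i\<in>J. x i)"
    using assms(2,3) by (intro sum.mono_neutral_cong_right) auto
  then have "\<forall>i\<in>I. ?y i = 0"
    using x indep_familyD[OF assms(1), of ?y] assms(4) by (metis (no_types, lifting))
  then show "\<forall>i\<in>J. x i = 0" using assms(2) by (metis subsetD)
qed

text \<open>Independence forces the new summand to meet the sum of the earlier ones in 0, so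
  dimensions add up one summand at a time.\<close>

lemma subspace_dim_family_sum:
  assumes "finite I" "\<And>i. i \<in> I \<Longrightarrow> subspace (X i)" "indep_family I X"
  shows "subspace (family_sum I X) \<and> dim (family_sum I X) = (\<Sum>i\<in>I. dim (X i))"
  using assms
proof (induction I rule: finite_induct)
  case (insert i I)
  have ind: "indep_family I X"
    using insert by (intro indep_family_subset[OF insert.prems(2)]) (auto intro: subspace_0)
  have IH: "subspace (family_sum I X)" "dim (family_sum I X) = (\<Sum>i\<in>I. dim (X i))"
    using insert.IH ind insert.prems(1) by auto
  have "X i \<inter> family_sum I X \<subseteq> {0}"
  proof
    fix v assume v: "v \<in> X i \<inter> family_sum I X"
    then obtain x where x: "\<And>i. i \<in> I \<Longrightarrow> x i \<in> X i" "v = (\<Sum>i\<in>I. x i)"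
      by (auto elim: family_sumE)
    \<comment> \<open>A common vector \<open>v\<close> gives a relation among the summands in which
      the entry at \<open>i\<close> is \<open>- v\<close>.\<close>
    let ?y = "x(i := - v)"
    have "(\<Sum>j\<in>insert i I. ?y j) = - v + (\<Sum>j\<in>I. ?y j)"
      using insert.hyps by simp
    also have "(\<Sum>j\<in>I. ?y j) = v"
      unfolding x(2) using insert.hyps by (intro sum.cong) auto
    finally have "(\<Sum>j\<in>insert i I. ?y j) = 0" by simp
    moreover have "?y j \<in> X j" if "j \<in> insert i I" for j
      using that v x(1) insert.prems(1)[of i] by (auto intro: subspace_neg)
    ultimately have "?y i = 0"
      using indep_familyD[OF insert.prems(2), of ?y i] by blast
    then show "v \<in> {0}" by simp
  qed
  then have "X i \<inter> family_sum I X = {0}"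
    using subspace_0[OF IH(1)] subspace_0[of "X i"] insert.prems(1) by blast
  then have "dim {a + b | a b. a \<in> X i \<and> b \<in> family_sum I X} = dim (X i) + dim (family_sum I X)"
    using dim_sums_Int[of "X i" "family_sum I X"] insert.prems(1) IH(1) by simp
  then show ?case
    using insert.hyps IH insert.prems(1) subspace_sums[of "X i" "family_sum I X"]
    by (simp add: family_sum_insert)
qed simp

section \<open>Cyclic subspaces of a nilpotent operator and their invariant complements\<close>

lemma linear_funpow:
  assumes "Vector_Spaces.linear scale scale N"
  shows "Vector_Spaces.linear scale scale (N ^^ k)"
proof (induction k)
  case 0
  then show ?case using linear_id by (simp add: id_def)
next
  case (Suc k)
  then show ?case
    using Vector_Spaces.linear_compose[OF Suc assms] by (simp add: o_def)
qed

lemma linear_add_scale: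
  assumes "Vector_Spaces.linear scale scale N"
  shows "N (x + y) = N x + N y" "N (scale c x) = scale c (N x)" "N 0 = 0" "N (x - y) = N x - N y"
    "N (sum f A) = (\<Sum>a\<in>A. N (f a))"
proof -
  interpret Vector_Spaces.linear scale scale N by fact
  show "N (x + y) = N x + N y" "N (scale c x) = scale c (N x)" "N 0 = 0" "N (x - y) = N x - N y"
    "N (sum f A) = (\<Sum>a\<in>A. N (f a))"
    by (simp_all add: add scale diff sum)
qed

lemma funpow_closed: "N ` W \<subseteq> W \<Longrightarrow> x \<in> W \<Longrightarrow> (N ^^ k) x \<in> W"
  by (induction k) auto

lemma exists_functional:
  assumes "v \<noteq> 0"
  obtains \<phi> :: "'b \<Rightarrow> 'a" where "\<phi> v = 1" "\<And>x y. \<phi> (x + y) = \<phi> x + \<phi> y"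
    "\<And>c x. \<phi> (scale c x) = c * \<phi> x"
proof -
  interpret F: vector_space_pair scale "(*) :: 'a \<Rightarrow> 'a \<Rightarrow> 'a"
    by unfold_locales (simp_all add: algebra_simps)
  obtain g where g: "\<forall>x\<in>{v}. g x = (1 :: 'a)" "Vector_Spaces.linear scale (*) g"
    using F.linear_independent_extend[of "{v}" "\<lambda>_. 1"] assms by auto
  interpret g: Vector_Spaces.linear scale "(*)" g by fact
  show ?thesis using g(1) by (intro that[of g]) (simp_all add: g.add g.scale)
qed

text \<open>The submodule generated by \<open>w\<close> over polynomials in \<open>N\<close>. All
  powers are taken, so that invariance under \<open>N\<close> holds without any bound on the
  nilpotency order.\<close>

definition cyclic_span :: "('b \<Rightarrow> 'b) \<Rightarrow> 'b \<Rightarrow> 'b set" where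
  "cyclic_span N w = span (range (\<lambda>i. (N ^^ i) w))"

lemma cyclic_span_closed:
  assumes N: "Vector_Spaces.linear scale scale N"
  shows "N ` cyclic_span N w \<subseteq> cyclic_span N w"
proof -
  interpret Vector_Spaces.linear scale scale N by fact
  have "N ` cyclic_span N w = span (N ` range (\<lambda>i. (N ^^ i) w))"
    unfolding cyclic_span_def by (rule span_image[symmetric])
  also have "\<dots> \<subseteq> cyclic_span N w"
    unfolding cyclic_span_def
  proof (rule span_mono, safe)
    fix i show "N ((N ^^ i) w) \<in> range (\<lambda>i. (N ^^ i) w)"
      by (rule image_eqI[of _ _ "Suc i"]) simp_all
  qed
  finally show ?thesis .
qed

text \<open>The vectors \<open>w\<close>, \<open>N w\<close>, ..., \<open>(N ^^ (h - 1)) w\<close>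
  form a basis, and \<open>N ^^ k\<close> shifts it by \<open>k\<close> places.\<close>

lemma dim_image_cyclic_span:
  assumes N: "Vector_Spaces.linear scale scale N"
    and h: "(N ^^ h) w = 0" "h > 0" "(N ^^ (h - 1)) w \<noteq> 0"
  shows "dim ((N ^^ k) ` cyclic_span N w) = h - k"
proof -
  have vanish: "(N ^^ i) w = 0" if "h \<le> i" for i
  proof -
    have "(N ^^ i) w = (N ^^ (i - h)) ((N ^^ h) w)"
      using that by (metis funpow_add o_apply le_add_diff_inverse2)
    then show ?thesis using h(1) linear_add_scale(3)[OF linear_funpow[OF N]] by simp
  qed
  have img: "(N ^^ k) ` cyclic_span N w = span ((\<lambda>i. (N ^^ i) w) ` {k..})" for k
  proof -
    interpret Vector_Spaces.linear scale scale "N ^^ k" using N by (rule linear_funpow)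
    have "(N ^^ k) ` range (\<lambda>i. (N ^^ i) w) = (\<lambda>i. (N ^^ i) w) ` {k..}"
    proof (intro equalityI subsetI)
      fix x assume "x \<in> (N ^^ k) ` range (\<lambda>i. (N ^^ i) w)"
      then obtain i where "x = (N ^^ (k + i)) w" by (auto simp: funpow_add)
      then show "x \<in> (\<lambda>i. (N ^^ i) w) ` {k..}" by (intro image_eqI[of _ _ "k + i"]) auto
    next
      fix x assume "x \<in> (\<lambda>i. (N ^^ i) w) ` {k..}"
      then obtain i where "i \<ge> k" "x = (N ^^ i) w" by auto
      then have "x = (N ^^ k) ((N ^^ (i - k)) w)"
        by (metis funpow_add o_apply le_add_diff_inverse)
      then show "x \<in> (N ^^ k) ` range (\<lambda>i. (N ^^ i) w)" by blast
    qed
    then show ?thesis unfolding cyclic_span_def by (simp add: span_image[symmetric])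
  qed
  \<comment> \<open>The basis is built from its tail: the last \<open>j\<close> vectors are
    independent.\<close>
  have "dim (span ((\<lambda>i. (N ^^ i) w) ` {h - j..})) = j" if "j \<le> h" for j
    using that
  proof (induction j)
    case 0
    have "(\<lambda>i. (N ^^ i) w) ` {h..} \<subseteq> {0}" using vanish by auto
    then show ?case by (simp add: dim_eq_0)
  next
    case (Suc j)
    let ?S = "(\<lambda>i. (N ^^ i) w) ` {h - j..}"
    have set: "{h - Suc j..} = insert (h - Suc j) {h - j..}"
      using Suc.prems by auto
    \<comment> \<open>\<open>N ^^ j\<close> annihilates the tail but maps the new vector to
      \<open>(N ^^ (h - 1)) w\<close>, which is nonzero.\<close>
    have "(N ^^ (h - Suc j)) w \<notin> span ?S"
    proof
      interpret Vector_Spaces.linear scale scale "N ^^ j" using N by (rule linear_funpow)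
      assume *: "(N ^^ (h - Suc j)) w \<in> span ?S"
      have "(N ^^ j) x = 0" if x: "x \<in> ?S" for x
      proof -
        obtain i where i: "i \<ge> h - j" "x = (N ^^ i) w" using x by auto
        then have "(N ^^ j) x = (N ^^ (j + i)) w" by (simp add: funpow_add)
        then show ?thesis using i vanish[of "j + i"] by simp
      qed
      then have "(N ^^ j) ((N ^^ (h - Suc j)) w) = 0"
        using eq_0_on_span[OF _ *] by blast
      moreover have "(N ^^ j) ((N ^^ (h - Suc j)) w) = (N ^^ (j + (h - Suc j))) w"
        by (simp add: funpow_add)
      moreover have "j + (h - Suc j) = h - 1" using Suc.prems by simp
      ultimately show False using h(3) by simp
    qed
    then have "dim (insert ((N ^^ (h - Suc j)) w) ?S) = dim ?S + 1"
      by (simp add: dim_insert)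
    then show ?case using Suc set by simp
  qed
  from this[of "h - k"] show ?thesis
  proof (cases "k \<le> h")
    case False
    have "(\<lambda>i. (N ^^ i) w) ` {k..} \<subseteq> {0}" using vanish False by auto
    then show ?thesis using False by (simp add: img dim_eq_0)
  qed (use img in auto)
qed

lemma cyclic_span_complement:
  assumes N: "Vector_Spaces.linear scale scale N"
    and W: "subspace W" "N ` W \<subseteq> W" "\<And>x. x \<in> W \<Longrightarrow> (N ^^ h) x = 0"
    and w: "w \<in> W" "h > 0" "(N ^^ (h - 1)) w \<noteq> 0"
  obtains B where "subspace B" "N ` B \<subseteq> B" "cyclic_span N w \<inter> B = {0}"
    "{c + b | c b. c \<in> cyclic_span N w \<and> b \<in> B} = W"
proof -
  \<comment> \<open>The complement consists of the vectors whose orbit is annihilated by a functional \<open>\<phi>\<close> with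
    \<open>\<phi> (N ^ (h - 1) w) = 1\<close>.\<close>
  obtain \<phi> :: "'b \<Rightarrow> 'a" where \<phi>: "\<phi> ((N ^^ (h - 1)) w) = 1"
    "\<And>x y. \<phi> (x + y) = \<phi> x + \<phi> y" "\<And>c x. \<phi> (scale c x) = c * \<phi> x"
    using exists_functional[OF w(3)] by blast
  note lin = linear_add_scale[OF N] linear_add_scale[OF linear_funpow[OF N]]
  have \<phi>0: "\<phi> 0 = 0" using \<phi>(3)[of 0 0] by simp
  have \<phi>d: "\<phi> (x - y) = \<phi> x - \<phi> y" for x y using \<phi>(2)[of "x - y" y] by simp
  define C where "C = cyclic_span N w"
  define B where "B = {x \<in> W. \<forall>i. \<phi> ((N ^^ i) x) = 0}"
  have vanish: "(N ^^ i) x = 0" if "x \<in> W" "h \<le> i" for i x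
  proof -
    have "(N ^^ i) x = (N ^^ (i - h)) ((N ^^ h) x)"
      using that by (metis funpow_add o_apply le_add_diff_inverse2)
    then show ?thesis using W(3) that lin by simp
  qed
  have B: "subspace B"
    unfolding B_def using W(1) \<phi> \<phi>0 lin
    by (intro subspaceI) (auto intro: subspace_0 subspace_add subspace_scale)
  have "\<phi> ((N ^^ i) (N x)) = 0" if "x \<in> B" for i x
    using that unfolding B_def by (auto simp flip: funpow_swap1 dest: spec[of _ "Suc i"])
  then have B_inv: "N ` B \<subseteq> B" unfolding B_def using W(2) by auto
  have C: "subspace C" unfolding C_def cyclic_span_def by simp
  have Cw: "(N ^^ i) w \<in> C" for i unfolding C_def cyclic_span_def by (intro span_base) auto
  have CW: "C \<subseteq> W"
    unfolding C_def cyclic_span_def using W(1,2) w(1)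
    by (intro span_minimal) (auto intro: funpow_closed)
  \<comment> \<open>The conditions for \<open>x - c\<close> to lie in \<open>B\<close> are met one
    at a time, from high powers of \<open>N\<close> downwards. Adding a multiple of
    \<open>(N ^^ k) w\<close> adjusts the condition at \<open>h - Suc k\<close> and leaves those at
    higher powers alone, because \<open>N ^^ h\<close> kills \<open>w\<close>.\<close>
  have solve: "\<exists>c\<in>C. \<forall>i\<ge>h - k. \<phi> ((N ^^ i) (x - c)) = 0" if x: "x \<in> W" for x k
  proof (induction k)
    case 0
    show ?case by (intro bexI[of _ 0]) (use vanish[OF x] subspace_0[OF C] in \<open>auto simp: \<phi>0\<close>)
  next
    case (Suc k)
    then obtain c where c: "c \<in> C" "\<forall>i\<ge>h - k. \<phi> ((N ^^ i) (x - c)) = 0" by blast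
    show ?case
    proof (cases "k < h")
      case False
      then show ?thesis using c by auto
    next
      case True
      define \<alpha> where "\<alpha> = \<phi> ((N ^^ (h - Suc k)) (x - c))"
      define c' where "c' = c + scale \<alpha> ((N ^^ k) w)"
      have "\<phi> ((N ^^ i) (x - c')) = 0" if i: "i \<ge> h - Suc k" for i
      proof -
        have *: "\<phi> ((N ^^ i) (x - c')) = \<phi> ((N ^^ i) (x - c)) - \<alpha> * \<phi> ((N ^^ (i + k)) w)"
          unfolding c'_def by (simp add: lin \<phi> \<phi>d funpow_add algebra_simps)
        show ?thesis
        proof (cases "i = h - Suc k")
          case True
          then have "i + k = h - 1" using \<open>k < h\<close> by simp
          then show ?thesis unfolding * using True using \<phi>(1) by (simp add: \<alpha>_def)
        next
          case False
          then have "i \<ge> h - k" "i + k \<ge> h" using i \<open>k < h\<close> by auto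
          then show ?thesis unfolding * using c(2) vanish[OF w(1)] by (simp add: \<phi>0)
        qed
      qed
      moreover have "c' \<in> C"
        unfolding c'_def using C c(1) Cw by (intro subspace_add subspace_scale)
      ultimately show ?thesis by blast
    qed
  qed
  have "{c + b | c b. c \<in> C \<and> b \<in> B} = W"
  proof (intro equalityI subsetI)
    fix x assume x: "x \<in> W"
    obtain c where c: "c \<in> C" "\<forall>i. \<phi> ((N ^^ i) (x - c)) = 0" using solve[OF x, of h] by auto
    then have "x - c \<in> B" unfolding B_def using x CW W(1) by (auto intro: subspace_diff)
    then show "x \<in> {c + b | c b. c \<in> C \<and> b \<in> B}"
      using c(1) by (intro CollectI exI[of _ c] exI[of _ "x - c"]) simp
  next
    fix x assume "x \<in> {c + b | c b. c \<in> C \<and> b \<in> B}"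
    then show "x \<in> W" using CW W(1) unfolding B_def by (auto intro: subspace_add)
  qed
  moreover have "C \<inter> B = {0}"
  proof -
    \<comment> \<open>The coefficients of \<open>x\<close> vanish one after the other: once
      \<open>x\<close> lies in the span of the \<open>(N ^^ i) w\<close> with
      \<open>i \<ge> k\<close>, the coefficient of \<open>(N ^^ k) w\<close> is
      \<open>\<phi> ((N ^^ (h - Suc k)) x)\<close>, which is 0 for \<open>x\<close> in
      \<open>B\<close>.\<close>
    have "x = 0" if x: "x \<in> C" "x \<in> B" for x
    proof -
      have "x \<in> span ((\<lambda>i. (N ^^ i) w) ` {k..})" if "k \<le> h" for k
        using that
      proof (induction k)
        case 0
        then show ?case using x(1) by (simp add: C_def cyclic_span_def atLeast_0)
      next
        case (Suc k)
        interpret M: Vector_Spaces.linear scale scale "N ^^ (h - Suc k)" using N by (rule linear_funpow)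
        let ?S = "(\<lambda>i. (N ^^ i) w) ` {Suc k..}"
        have "{k..} = insert k {Suc k..}" by auto
        then obtain a where a: "x - scale a ((N ^^ k) w) \<in> span ?S"
          using Suc by (auto simp: span_breakdown_eq)
        have "(N ^^ (h - Suc k)) y = 0" if y: "y \<in> ?S" for y
        proof -
          obtain i where i: "i \<ge> Suc k" "y = (N ^^ i) w" using y by auto
          then have "(N ^^ (h - Suc k)) y = (N ^^ (h - Suc k + i)) w" by (simp add: funpow_add)
          then show ?thesis using i vanish[OF w(1)] Suc.prems by simp
        qed
        then have "(N ^^ (h - Suc k)) (x - scale a ((N ^^ k) w)) = 0"
          using M.eq_0_on_span[OF _ a] by blast
        then have "(N ^^ (h - Suc k)) x = scale a ((N ^^ (h - Suc k + k)) w)"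
          by (simp add: lin funpow_add)
        moreover have "h - Suc k + k = h - 1" using Suc.prems by simp
        ultimately have "\<phi> ((N ^^ (h - Suc k)) x) = a" using \<phi> by simp
        then have "a = 0" using x(2) unfolding B_def by simp
        then show ?case using a by simp
      qed
      from this[of h] have "x \<in> span ((\<lambda>i. (N ^^ i) w) ` {h..})" by simp
      moreover have "(\<lambda>i. (N ^^ i) w) ` {h..} \<subseteq> {0}" using vanish[OF w(1)] by auto
      ultimately have "x \<in> span {0}" using span_mono by blast
      then show ?thesis by simp
    qed
    then show ?thesis using subspace_0[OF C] subspace_0[OF B] by blast
  qed
  ultimately show ?thesis using that B B_inv unfolding C_def by blast
qed


section \<open>Indecomposable summands as Jordan blocks\<close>

text \<open>A vector \<open>w\<close> surviving as long as any vector of \<open>W\<close> generates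
  a cyclic subspace with an invariant complement. Indecomposability makes the complement zero, so
  \<open>W\<close> is a single Jordan block.\<close>

lemma indecomposable_dim_image:
  assumes N: "Vector_Spaces.linear scale scale N"
    and nil: "\<And>x. (N ^^ P) x = 0"
    and sub: "\<And>W. subrep Q scale \<rho> W \<longleftrightarrow> subspace W \<and> N ` W \<subseteq> W"
    and W: "indecomposable_subrep Q scale \<rho> W"
  shows "dim ((N ^^ k) ` W) = dim W - k"
proof -
  have W': "subspace W" "N ` W \<subseteq> W" "W \<noteq> {0}"
    using W sub unfolding indecomposable_subrep_def by auto
  define h where "h = (LEAST h. \<forall>x\<in>W. (N ^^ h) x = 0)"
  have h: "\<forall>x\<in>W. (N ^^ h) x = 0"
    unfolding h_def by (rule LeastI[of _ P]) (use nil in auto)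
  have "h > 0"
  proof (rule ccontr)
    assume "\<not> h > 0"
    then have "\<forall>x\<in>W. x = 0" using h by simp
    then show False using W'(3) subspace_0[OF W'(1)] by auto
  qed
  then have "\<not> (\<forall>x\<in>W. (N ^^ (h - 1)) x = 0)"
    using not_less_Least[of "h - 1" "\<lambda>h. \<forall>x\<in>W. (N ^^ h) x = 0"] unfolding h_def by simp
  then obtain w where w: "w \<in> W" "(N ^^ (h - 1)) w \<noteq> 0" by blast
  obtain B where B: "subspace B" "N ` B \<subseteq> B" "cyclic_span N w \<inter> B = {0}"
    "{c + b | c b. c \<in> cyclic_span N w \<and> b \<in> B} = W"
    by (rule cyclic_span_complement[OF N W'(1,2) bspec[OF h] w(1) \<open>h > 0\<close> w(2)])
  have "w \<in> cyclic_span N w"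
    unfolding cyclic_span_def using rangeI[of "\<lambda>i. (N ^^ i) w" 0] by (intro span_base) simp
  moreover have "w \<noteq> 0" using w(2) linear_add_scale(3)[OF linear_funpow[OF N]] by auto
  moreover have "subspace (cyclic_span N w)" unfolding cyclic_span_def by simp
  ultimately have C: "subrep Q scale \<rho> (cyclic_span N w)" "cyclic_span N w \<noteq> {0}"
    using cyclic_span_closed[OF N, of w] sub by auto
  have "subrep Q scale \<rho> B" using B(1,2) sub by simp
  have dec: "A = {0} \<or> B = {0}" if "subrep Q scale \<rho> A" "subrep Q scale \<rho> B"
      "A \<inter> B = {0}" "{a + b | a b. a \<in> A \<and> b \<in> B} = W" for A B
    using W[unfolded indecomposable_subrep_def, THEN conjunct2, THEN conjunct2, rule_format, of A B]
      that by simp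
  have "B = {0}" using dec[OF C(1) \<open>subrep Q scale \<rho> B\<close> B(3,4)] C(2) by simp
  then have WC: "W = cyclic_span N w" using B(4) by auto
  have dim: "dim ((N ^^ k) ` W) = h - k" for k
    unfolding WC by (rule dim_image_cyclic_span[OF N bspec[OF h w(1)] \<open>h > 0\<close> w(2)])
  from dim[of 0] dim[of k] show ?thesis by simp
qed

text \<open>For subspaces, existence of the tuple \<open>w\<close> means that the summands span, and
  its uniqueness means that they are independent. \<open>restrict\<close> passes from arbitrary
  choices to the extensional ones of the definition.\<close>

lemma indecomposable_decomposition_iff:
  "indecomposable_decomposition Q scale \<rho> \<W> \<longleftrightarrow>
     finite \<W> \<and> (\<forall>W\<in>\<W>. indecomposable_subrep Q scale \<rho> W) \<and>
     indep_family \<W> (\<lambda>W. W) \<and> family_sum \<W> (\<lambda>W. W) = UNIV"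
proof (cases "finite \<W> \<and> (\<forall>W\<in>\<W>. indecomposable_subrep Q scale \<rho> W)")
  case True
  then have sub: "subspace W" if "W \<in> \<W>" for W
    using that unfolding indecomposable_subrep_def subrep_def by blast
  have res: "(\<Sum>W\<in>\<W>. restrict x \<W> W) = (\<Sum>W\<in>\<W>. x W)" for x :: "'b set \<Rightarrow> 'b"
    by (intro sum.cong) auto
  have "(\<forall>v. \<exists>!w. w \<in> (\<Pi>\<^sub>E W\<in>\<W>. W) \<and> v = (\<Sum>W\<in>\<W>. w W)) \<longleftrightarrow>
        indep_family \<W> (\<lambda>W. W) \<and> family_sum \<W> (\<lambda>W. W) = UNIV" (is "?L \<longleftrightarrow> ?R")
  proof
    assume L: ?L
    have "x W = 0" if x: "\<forall>W\<in>\<W>. x W \<in> W" "(\<Sum>W\<in>\<W>. x W) = 0" and W: "W \<in> \<W>" for x W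
    proof -
      have "restrict x \<W> \<in> (\<Pi>\<^sub>E W\<in>\<W>. W) \<and> 0 = (\<Sum>W\<in>\<W>. restrict x \<W> W)"
        using x res[of x] by auto
      moreover have "restrict (\<lambda>_. 0) \<W> \<in> (\<Pi>\<^sub>E W\<in>\<W>. W) \<and> 0 = (\<Sum>W\<in>\<W>. restrict (\<lambda>_. 0) \<W> W)"
        using sub res[of "\<lambda>_. 0"] by (auto intro: subspace_0)
      ultimately have "restrict x \<W> = restrict (\<lambda>_. 0) \<W>" using L by blast
      then show ?thesis using W by (metis restrict_apply')
    qed
    moreover have "v \<in> family_sum \<W> (\<lambda>W. W)" for v
    proof -
      obtain w where "w \<in> (\<Pi>\<^sub>E W\<in>\<W>. W)" "v = (\<Sum>W\<in>\<W>. w W)" using L by blast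
      then show ?thesis by (auto intro!: family_sumI)
    qed
    ultimately show ?R unfolding indep_family_def by blast
  next
    assume R: ?R
    show ?L
    proof (intro allI ex_ex1I)
      fix v
      have "v \<in> family_sum \<W> (\<lambda>W. W)" using R by simp
      then obtain x where x: "\<And>W. W \<in> \<W> \<Longrightarrow> x W \<in> W" "v = (\<Sum>W\<in>\<W>. x W)"
        by (rule family_sumE) blast
      then have "restrict x \<W> \<in> (\<Pi>\<^sub>E W\<in>\<W>. W) \<and> v = (\<Sum>W\<in>\<W>. restrict x \<W> W)"
        using res[of x] by auto
      then show "\<exists>w. w \<in> (\<Pi>\<^sub>E W\<in>\<W>. W) \<and> v = (\<Sum>W\<in>\<W>. w W)" by blast
    next
      fix v w w' assume w: "w \<in> (\<Pi>\<^sub>E W\<in>\<W>. W) \<and> v = (\<Sum>W\<in>\<W>. w W)"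
        and w': "w' \<in> (\<Pi>\<^sub>E W\<in>\<W>. W) \<and> v = (\<Sum>W\<in>\<W>. w' W)"
      have "w W - w' W = 0" if "W \<in> \<W>" for W
        using R w w' sub that
        by (intro indep_familyD[of \<W> "\<lambda>W. W" "\<lambda>W. w W - w' W"])
          (auto simp: sum_subtractf intro!: subspace_diff)
      then show "w = w'"
        using w w' by (intro PiE_ext[of w \<W> "\<lambda>W. W" w']) auto
    qed
  qed
  then show ?thesis unfolding indecomposable_decomposition_def using True by blast
qed (auto simp: indecomposable_decomposition_def)

text \<open>Strong induction on the dimension: a nonzero decomposable \<open>W\<close> splits into
  two parts of smaller dimension.\<close>

lemma exists_decomposition:
  assumes "subrep Q scale \<rho> W"
  shows "\<exists>\<W>. finite \<W> \<and> (\<forall>U\<in>\<W>. indecomposable_subrep Q scale \<rho> U) \<and>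
              indep_family \<W> (\<lambda>U. U) \<and> family_sum \<W> (\<lambda>U. U) = W"
  using assms
proof (induction "dim W" arbitrary: W rule: less_induct)
  case less
  show ?case
  proof (cases "W = {0} \<or> indecomposable_subrep Q scale \<rho> W")
    case True
    then show ?thesis
    proof
      assume "W = {0}"
      then show ?thesis by (intro exI[of _ "{}"]) (auto simp: indep_family_def)
    next
      assume "indecomposable_subrep Q scale \<rho> W"
      then show ?thesis by (intro exI[of _ "{W}"]) (auto simp: indep_family_def)
    qed
  next
    case False
    then obtain A B where AB: "subrep Q scale \<rho> A" "subrep Q scale \<rho> B"
        "A \<inter> B = {0}" "{a + b | a b. a \<in> A \<and> b \<in> B} = W" "A \<noteq> {0}" "B \<noteq> {0}"
      using less.prems unfolding indecomposable_subrep_def by blast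
    have sub: "subspace A" "subspace B" using AB(1,2) unfolding subrep_def by auto
    have "dim W = dim A + dim B"
      using dim_sums_Int[OF sub] AB(3,4) by simp
    moreover have "dim A \<noteq> 0" "dim B \<noteq> 0"
      unfolding dim_eq_0 using AB(5,6) subspace_0[OF sub(1)] subspace_0[OF sub(2)] by blast+
    ultimately have lt: "dim A < dim W" "dim B < dim W" by linarith+
    obtain \<A> \<B> where
        A: "finite \<A>" "\<forall>U\<in>\<A>. indecomposable_subrep Q scale \<rho> U"
          "indep_family \<A> (\<lambda>U. U)" "family_sum \<A> (\<lambda>U. U) = A" and
        B: "finite \<B>" "\<forall>U\<in>\<B>. indecomposable_subrep Q scale \<rho> U"
          "indep_family \<B> (\<lambda>U. U)" "family_sum \<B> (\<lambda>U. U) = B"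
      using less.hyps[OF lt(1) AB(1)] less.hyps[OF lt(2) AB(2)] by blast
    have summand: "U \<subseteq> family_sum \<C> (\<lambda>U. U)"
      if \<C>: "finite \<C>" "\<forall>U\<in>\<C>. indecomposable_subrep Q scale \<rho> U" "U \<in> \<C>" for U \<C>
    proof
      fix u assume "u \<in> U"
      have "(\<Sum>V\<in>\<C>. if V = U then u else 0) \<in> family_sum \<C> (\<lambda>U. U)"
      proof (rule family_sumI)
        fix V assume "V \<in> \<C>"
        then have "subspace V" using \<C>(2) unfolding indecomposable_subrep_def subrep_def by blast
        then show "(if V = U then u else 0) \<in> V" using \<open>u \<in> U\<close> by (auto intro: subspace_0)
      qed
      then show "u \<in> family_sum \<C> (\<lambda>U. U)" using \<C>(1,3) by simp
    qed
    \<comment> \<open>Since decompositions are sets, a summand occurring on both sides would be lost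
      in the union. It would lie in \<open>A \<inter> B = {0}\<close>, whereas indecomposables are
      nonzero.\<close>
    have disj: "\<A> \<inter> \<B> = {}"
    proof (rule ccontr)
      assume "\<A> \<inter> \<B> \<noteq> {}"
      then obtain U where U: "U \<in> \<A>" "U \<in> \<B>" by blast
      then have "U \<subseteq> A \<inter> B" using summand[OF A(1,2)] summand[OF B(1,2)] A(4) B(4) by blast
      moreover have "subspace U" "U \<noteq> {0}"
        using U A(2) unfolding indecomposable_subrep_def subrep_def by auto
      ultimately show False using AB(3) subspace_0 by blast
    qed
    have "indep_family (\<A> \<union> \<B>) (\<lambda>U. U)"
      using A B sub AB(3) disj by (intro indep_family_union) auto
    moreover have "family_sum (\<A> \<union> \<B>) (\<lambda>U. U) = W"
      using family_sum_union[OF A(1) B(1) disj, of "\<lambda>U. U"] A(4) B(4) AB(4) by simp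
    ultimately show ?thesis
      using A(1,2) B(1,2) by (intro exI[of _ "\<A> \<union> \<B>"]) auto
  qed
qed

text \<open>The images of the summands stay inside the summands, hence remain independent, and they
  sum to the range. A Jordan block of size \<open>d\<close> contributes \<open>d - k\<close> with
  truncated subtraction. The right-hand side does not involve \<open>\<W>\<close>.\<close>

lemma decomposition_dims:
  assumes N: "Vector_Spaces.linear scale scale N"
    and nil: "\<And>x. (N ^^ P) x = 0"
    and sub: "\<And>W. subrep Q scale \<rho> W \<longleftrightarrow> subspace W \<and> N ` W \<subseteq> W"
    and dec: "indecomposable_decomposition Q scale \<rho> \<W>"
  shows "(\<Sum>W\<in>\<W>. dim W - k) = dim (range (N ^^ k))"
proof -
  note dec' = dec[unfolded indecomposable_decomposition_iff]
  note lin = linear_add_scale[OF linear_funpow[OF N]]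
  interpret Vector_Spaces.linear scale scale "N ^^ k" using N by (rule linear_funpow)
  have W: "subspace W" "N ` W \<subseteq> W" if "W \<in> \<W>" for W
    using that dec' sub unfolding indecomposable_subrep_def by auto
  have "indep_family \<W> (\<lambda>W. (N ^^ k) ` W)"
    unfolding indep_family_def
  proof (intro allI impI)
    fix x assume x: "(\<forall>W\<in>\<W>. x W \<in> (N ^^ k) ` W) \<and> sum x \<W> = 0"
    have "x W \<in> W" if "W \<in> \<W>" for W
      using x that funpow_closed[OF W(2)[OF that], of _ k] by auto
    then show "\<forall>W\<in>\<W>. x W = 0" using dec' x indep_familyD[of \<W> "\<lambda>W. W" x] by blast
  qed
  moreover have "subspace ((N ^^ k) ` W)" if "W \<in> \<W>" for W
    using W(1)[OF that] by (rule subspace_image)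
  ultimately have "dim (family_sum \<W> (\<lambda>W. (N ^^ k) ` W)) = (\<Sum>W\<in>\<W>. dim ((N ^^ k) ` W))"
    using subspace_dim_family_sum dec' by blast
  also have "\<dots> = (\<Sum>W\<in>\<W>. dim W - k)"
    using dec' by (intro sum.cong indecomposable_dim_image[OF N nil sub]) auto
  also have "family_sum \<W> (\<lambda>W. (N ^^ k) ` W) = range (N ^^ k)"
  proof (intro equalityI subsetI)
    fix v assume "v \<in> family_sum \<W> (\<lambda>W. (N ^^ k) ` W)"
    then obtain x where x: "\<And>W. W \<in> \<W> \<Longrightarrow> x W \<in> (N ^^ k) ` W" "v = (\<Sum>W\<in>\<W>. x W)"
      by (rule family_sumE) blast
    have "subspace (range (N ^^ k))" by (rule subspace_image) simp
    then show "v \<in> range (N ^^ k)" unfolding x(2) by (rule subspace_sum) (use x(1) in auto)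
  next
    fix v assume "v \<in> range (N ^^ k)"
    then obtain u where u: "v = (N ^^ k) u" by blast
    have "u \<in> family_sum \<W> (\<lambda>W. W)" using dec' by simp
    then obtain x where x: "\<And>W. W \<in> \<W> \<Longrightarrow> x W \<in> W" "u = (\<Sum>W\<in>\<W>. x W)"
      by (rule family_sumE) blast
    have "v = (\<Sum>W\<in>\<W>. (N ^^ k) (x W))" unfolding u x(2) by (rule lin)
    then show "v \<in> family_sum \<W> (\<lambda>W. (N ^^ k) ` W)" using x(1) by (auto intro!: family_sumI)
  qed
  finally show ?thesis by simp
qed

end

section \<open>Block sizes recovered from ranks\<close>

text \<open>The second difference in \<open>k\<close> of the truncated \<open>d - k\<close> is the
  indicator of \<open>d = Suc k\<close>. It is written additively because subtraction on the
  naturals truncates.\<close>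

lemma count_Suc_eq_second_difference:
  "count M (Suc k) + 2 * (\<Sum>d\<in>#M. d - Suc k) = (\<Sum>d\<in>#M. d - k) + (\<Sum>d\<in>#M. d - Suc (Suc k))"
proof (induction M)
  case (add x M)
  have x: "(if x = Suc k then 1 else 0) + 2 * (x - Suc k) = (x - k) + (x - Suc (Suc k))"
    by (cases "x \<le> k"; cases "x = Suc k"; simp)
  have "count (add_mset x M) (Suc k) + 2 * (\<Sum>d\<in>#add_mset x M. d - Suc k)
      = ((if x = Suc k then 1 else 0) + 2 * (x - Suc k)) +
        (count M (Suc k) + 2 * (\<Sum>d\<in>#M. d - Suc k))"
    by (simp add: algebra_simps)
  also have "\<dots> = (\<Sum>d\<in>#add_mset x M. d - k) + (\<Sum>d\<in>#add_mset x M. d - Suc (Suc k))"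
    unfolding x add.IH by (simp add: algebra_simps)
  finally show ?case .
qed simp

text \<open>Second differences recover the multiplicity of every positive number. Truncated sums do
  not see zeros, which are therefore excluded.\<close>

lemma mset_eqI_truncated_sums:
  fixes M M' :: "nat multiset"
  assumes "0 \<notin># M" "0 \<notin># M'" "\<And>k. (\<Sum>d\<in>#M. d - k) = (\<Sum>d\<in>#M'. d - k)"
  shows "M = M'"
proof (rule multiset_eqI)
  fix x
  show "count M x = count M' x"
  proof (cases x)
    case 0
    then show ?thesis using assms(1,2) by (simp add: not_in_iff)
  next
    case (Suc k)
    then show ?thesis
      using count_Suc_eq_second_difference[of M k] count_Suc_eq_second_difference[of M' k] assms(3)
      by simp
  qed
qed

context finite_dimensional_vector_space
begin

text \<open>The uniqueness behind the description operator: in every decomposition the truncated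
  sums of the dimensions are the ranks of the powers of \<open>N\<close>, and these determine the
  multiset.\<close>

lemma indecomposable_dims_nilpotent:
  assumes N: "Vector_Spaces.linear scale scale N"
    and nil: "\<And>x. (N ^^ P) x = 0"
    and sub: "\<And>W. subrep Q scale \<rho> W \<longleftrightarrow> subspace W \<and> N ` W \<subseteq> W"
  shows "0 \<notin># indecomposable_dims Q scale \<rho>"
    and "(\<Sum>d\<in>#indecomposable_dims Q scale \<rho>. d - k) = dim (range (N ^^ k))"
proof -
  let ?P = "\<lambda>M. \<exists>\<W>. indecomposable_decomposition Q scale \<rho> \<W> \<and> M = image_mset dim (mset_set \<W>)"
  have props: "0 \<notin># M \<and> (\<forall>k. (\<Sum>d\<in>#M. d - k) = dim (range (N ^^ k)))" if "?P M" for M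
  proof -
    obtain \<W> where \<W>: "indecomposable_decomposition Q scale \<rho> \<W>" "M = image_mset dim (mset_set \<W>)"
      using \<open>?P M\<close> by blast
    have "dim W \<noteq> 0" if "W \<in> \<W>" for W
    proof -
      have "subspace W" "W \<noteq> {0}"
        using that \<W>(1) unfolding indecomposable_decomposition_def indecomposable_subrep_def subrep_def
        by auto
      then show ?thesis unfolding dim_eq_0 using subspace_0 by blast
    qed
    moreover have "finite \<W>" using \<W>(1) unfolding indecomposable_decomposition_def by blast
    moreover have "(\<Sum>d\<in>#M. d - k) = dim (range (N ^^ k))" for k
      using decomposition_dims[OF N nil sub \<W>(1), of k]
      by (simp add: \<W>(2) sum_unfold_sum_mset multiset.map_comp o_def)
    ultimately show ?thesis using \<W>(2) by auto
  qed
  have "subrep Q scale \<rho> UNIV" using sub by simp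
  then have "\<exists>\<W>. indecomposable_decomposition Q scale \<rho> \<W>"
    using exists_decomposition unfolding indecomposable_decomposition_iff by blast
  then have ex: "\<exists>M. ?P M" by blast
  have "M = M'" if "?P M" "?P M'" for M M'
    using props[OF that(1)] props[OF that(2)] by (intro mset_eqI_truncated_sums) auto
  with ex have "\<exists>!M. ?P M" by (intro ex_ex1I)
  then have "?P (indecomposable_dims Q scale \<rho>)"
    unfolding indecomposable_dims_def by (rule theI')
  then show "0 \<notin># indecomposable_dims Q scale \<rho>"
    "(\<Sum>d\<in>#indecomposable_dims Q scale \<rho>. d - k) = dim (range (N ^^ k))"
    using props by auto
qed

end

section \<open>Restriction to subgroups\<close>

text \<open>From \<open>k * (p ^ r choose k) = p ^ r * ((p ^ r - 1) choose (k - 1))\<close>: if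
  \<open>p\<close> did not divide the coefficient, \<open>p ^ r\<close> would divide the smaller
  positive number \<open>k\<close>.\<close>

lemma of_nat_choose_prime_power_CHAR:
  assumes "prime p" "CHAR('a::semiring_1) = p" "0 < k" "k < p ^ r"
  shows "of_nat (p ^ r choose k) = (0 :: 'a)"
proof -
  have "p dvd (p ^ r choose k)"
  proof (rule ccontr)
    assume "\<not> p dvd (p ^ r choose k)"
    then have "coprime (p ^ r) (p ^ r choose k)"
      using assms(1) by (simp add: prime_imp_coprime)
    moreover have "k * (p ^ r choose k) = p ^ r * ((p ^ r - 1) choose (k - 1))"
      using assms(3,4) by (metis binomial_absorption One_nat_def Suc_pred)
    ultimately have "p ^ r dvd k"
      by (metis coprime_dvd_mult_left_iff dvd_triv_left)
    then show False using assms(3,4) by (auto dest: dvd_imp_le)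
  qed
  then show ?thesis using assms(2) by (simp add: of_nat_eq_0_iff_char_dvd)
qed

section \<open>Counting numbers below a bound in residue classes\<close>

text \<open>For \<open>a < P\<close>, the number of \<open>x < d\<close> congruent to
  \<open>a\<close> modulo \<open>P\<close>, that is, \<open>(d - a) / P\<close> rounded up. It is 0
  when \<open>a \<ge> d\<close>.\<close>

definition progression_card :: "nat \<Rightarrow> nat \<Rightarrow> nat \<Rightarrow> nat" where
  "progression_card P d a = (d - a + P - 1) div P"

lemma less_progression_card_iff:
  assumes "P > 0"
  shows "q < progression_card P d a \<longleftrightarrow> a + q * P < d"
proof -
  have "q < progression_card P d a \<longleftrightarrow> Suc q * P \<le> d - a + P - 1"
    unfolding progression_card_def Suc_le_eq[symmetric] using assms by (simp add: less_eq_div_iff_mult_less_eq)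
  then show ?thesis using assms by auto
qed

lemma sum_mod_classes:
  fixes f :: "nat \<Rightarrow> 'a::comm_monoid_add"
  assumes "P > 0"
  shows "(\<Sum>x<d. f x) = (\<Sum>a<P. \<Sum>q<progression_card P d a. f (a + q * P))"
proof -
  have "(\<Sum>a<P. \<Sum>q<progression_card P d a. f (a + q * P)) =
      (\<Sum>(a, q)\<in>(SIGMA a:{..<P}. {..<progression_card P d a}). f (a + q * P))"
    by (simp add: sum.Sigma)
  also have "\<dots> = (\<Sum>x<d. f x)"
    using assms
    by (intro sum.reindex_bij_witness[of _ "\<lambda>x. (x mod P, x div P)" "\<lambda>(a, q). a + q * P"])
      (auto simp: less_progression_card_iff)
  finally show ?thesis by simp
qed

text \<open>Dropping \<open>k\<close> elements from each class has the same effect as shortening the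
  range by \<open>P * k\<close>; the classes then partition what is left.\<close>

lemma sum_progression_card_diff:
  assumes "P > 0"
  shows "(\<Sum>a<P. progression_card P d a - k) = d - P * k"
proof -
  have "progression_card P d a - k = progression_card P (d - P * k) a" for a
  proof (rule ccontr)
    assume *: "progression_card P d a - k \<noteq> progression_card P (d - P * k) a"
    have "q < progression_card P d a - k \<longleftrightarrow> q < progression_card P (d - P * k) a" for q
      using less_progression_card_iff[OF assms, of "q + k" d a]
        less_progression_card_iff[OF assms, of q "d - P * k" a] by (auto simp: algebra_simps)
    then show False using * by (meson linorder_neqE_nat less_irrefl)
  qed
  then show ?thesis using sum_mod_classes[OF assms, of "\<lambda>_. 1 :: nat" "d - P * k"] by simp
qed

lemma sum_mset_image_sum_mset:
  "(\<Sum>x\<in>#(\<Sum>d\<in>#M. g d). F x) = (\<Sum>d\<in>#M. \<Sum>x\<in>#g d. F x)"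
  for F :: "_ \<Rightarrow> 'c::comm_monoid_add"
  by (induction M) auto

lemma sum_mset_filter_nonzero:
  "F 0 = 0 \<Longrightarrow> (\<Sum>x\<in>#filter_mset (\<lambda>x. x \<noteq> 0) M. F x) = (\<Sum>x\<in>#M. F x)"
  for F :: "nat \<Rightarrow> 'c::comm_monoid_add"
  by (induction M) auto

text \<open>The truncated sums identify \<open>M'\<close> as the multiset of nonzero class sizes.
  The condition \<open>F 0 = 0\<close> lets empty classes stay in the sum on the right.\<close>

lemma sum_mset_progressions:
  fixes M M' :: "nat multiset" and F :: "nat \<Rightarrow> 'c::comm_monoid_add"
  assumes P: "P > 0" and M': "0 \<notin># M'" "\<And>k. (\<Sum>d\<in>#M'. d - k) = (\<Sum>d\<in>#M. d - P * k)"
    and F: "F 0 = 0"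
  shows "(\<Sum>d\<in>#M'. F d) = (\<Sum>d\<in>#M. \<Sum>a<P. F (progression_card P d a))"
proof -
  define L where "L = filter_mset (\<lambda>x. x \<noteq> 0)
    (\<Sum>d\<in>#M. image_mset (progression_card P d) (mset_set {..<P}))"
  have L: "(\<Sum>x\<in>#L. G x) = (\<Sum>d\<in>#M. \<Sum>a<P. G (progression_card P d a))" if "G 0 = 0"
    for G :: "nat \<Rightarrow> 'e::comm_monoid_add"
    unfolding L_def sum_mset_filter_nonzero[of G, OF that] sum_mset_image_sum_mset
    by (simp add: multiset.map_comp o_def sum_unfold_sum_mset)
  have "M' = L"
  proof (rule mset_eqI_truncated_sums)
    show "0 \<notin># L" unfolding L_def by simp
    show "(\<Sum>d\<in>#M'. d - k) = (\<Sum>d\<in>#L. d - k)" for k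
      unfolding M'(2) using L[of "\<lambda>d. d - k"] by (simp add: sum_progression_card_diff P)
  qed fact
  then show ?thesis using L[of F] F by simp
qed

section \<open>The generator of a cyclic representation and its powers\<close>

lemma cyclic_rep_restrict:
  assumes \<rho>: "cyclic_rep (p ^ n) scale \<rho>" and "p > 0" "r \<le> n"
  shows "cyclic_rep (p ^ (n - r)) scale (restrict_rep p r \<rho>)"
proof -
  let ?Q = "p ^ (n - r)"
  have split: "int (p ^ n) = int p ^ r * int ?Q"
    using assms(3) by (simp flip: power_add)
  have car: "int p ^ r * x \<in> carrier (integer_mod_group (p ^ n))"
    if "x \<in> carrier (integer_mod_group ?Q)" for x
  proof -
    have "0 \<le> x" "x < int ?Q" using that assms(2) by (auto simp: carrier_integer_mod_group)
    then have "0 \<le> int p ^ r * x" "int p ^ r * x < int p ^ r * int ?Q"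
      using assms(2) by simp_all
    then show ?thesis using assms(2) unfolding split[symmetric] by (simp add: carrier_integer_mod_group)
  qed
  show ?thesis
    unfolding cyclic_rep_def
  proof (rule homI)
    fix x assume "x \<in> carrier (integer_mod_group ?Q)"
    then show "restrict_rep p r \<rho> x \<in> carrier (general_linear_group scale)"
      using \<rho> car unfolding cyclic_rep_def restrict_rep_def by (blast intro: hom_in_carrier)
  next
    fix x y assume xy: "x \<in> carrier (integer_mod_group ?Q)" "y \<in> carrier (integer_mod_group ?Q)"
    \<comment> \<open>Scaling by \<open>p ^ r\<close> turns reduction modulo \<open>?Q\<close> into
      reduction modulo \<open>p ^ n\<close>.\<close>
    have "int p ^ r * ((x + y) mod int ?Q) = (int p ^ r * x + int p ^ r * y) mod int (p ^ n)"
      unfolding split by (simp add: mod_mult_mult1 flip: distrib_left)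
    then show "restrict_rep p r \<rho> (x \<otimes>\<^bsub>integer_mod_group ?Q\<^esub> y) =
        restrict_rep p r \<rho> x \<otimes>\<^bsub>general_linear_group scale\<^esub> restrict_rep p r \<rho> y"
      using hom_mult[OF \<rho>[unfolded cyclic_rep_def] car[OF xy(1)] car[OF xy(2)]]
      unfolding restrict_rep_def by simp
  qed
qed

context finite_dimensional_vector_space
begin

text \<open>The binomial theorem for the commuting operators \<open>id\<close> and
  \<open>T - id\<close>.\<close>

lemma funpow_binomial:
  assumes T: "Vector_Spaces.linear scale scale T"
  shows "(T ^^ m) x = (\<Sum>k\<le>m. scale (of_nat (m choose k)) (((\<lambda>x. T x - x) ^^ k) x))"
proof (induction m)
  case (Suc m)
  let ?N = "\<lambda>x. T x - x"
  interpret T: Vector_Spaces.linear scale scale T by fact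
  have "(T ^^ Suc m) x = (\<Sum>k\<le>m. scale (of_nat (m choose k)) (T ((?N ^^ k) x)))"
    by (simp add: Suc T.sum T.scale)
  also have "\<dots> = (\<Sum>k\<le>m. scale (of_nat (m choose k)) ((?N ^^ k) x)) +
      (\<Sum>k\<le>m. scale (of_nat (m choose k)) ((?N ^^ Suc k) x))"
    by (simp add: scale_right_diff_distrib flip: sum.distrib)
  \<comment> \<open>The added coefficient \<open>m choose Suc m\<close> is 0. With the term
    \<open>k = 0\<close> split off, Pascal's rule applies termwise.\<close>
  also have "(\<Sum>k\<le>m. scale (of_nat (m choose k)) ((?N ^^ k) x)) =
      (\<Sum>k\<le>Suc m. scale (of_nat (m choose k)) ((?N ^^ k) x))"
    by (simp add: binomial_eq_0)
  also have "\<dots> = x + (\<Sum>k\<le>m. scale (of_nat (m choose Suc k)) ((?N ^^ Suc k) x))"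
    by (subst sum.atMost_Suc_shift) simp
  also have "\<dots> + (\<Sum>k\<le>m. scale (of_nat (m choose k)) ((?N ^^ Suc k) x)) =
      x + (\<Sum>k\<le>m. scale (of_nat (Suc m choose Suc k)) ((?N ^^ Suc k) x))"
    by (simp add: scale_left_distrib add_ac flip: sum.distrib del: funpow.simps)
  also have "\<dots> = (\<Sum>k\<le>Suc m. scale (of_nat (Suc m choose k)) ((?N ^^ k) x))"
    by (subst sum.atMost_Suc_shift) simp
  finally show ?case .
qed simp

text \<open>In characteristic \<open>p\<close> only the two extreme binomial coefficients of a
  \<open>p ^ r\<close>-th power survive.\<close>

lemma funpow_prime_power_minus:
  assumes T: "Vector_Spaces.linear scale scale T" and p: "prime p" "CHAR('a) = p"
  shows "((\<lambda>x. T x - x) ^^ (p ^ r)) x = (T ^^ (p ^ r)) x - x"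
proof -
  let ?N = "\<lambda>x. T x - x"
  have "(T ^^ (p ^ r)) x = (\<Sum>k\<in>{0, p ^ r}. scale (of_nat (p ^ r choose k)) ((?N ^^ k) x))"
    unfolding funpow_binomial[OF T]
    by (rule sum.mono_neutral_right) (auto simp: of_nat_choose_prime_power_CHAR[OF p])
  also have "\<dots> = x + (?N ^^ (p ^ r)) x" using p(1) by (auto simp: prime_gt_0_nat)
  finally show ?thesis by simp
qed

lemma linear_minus_id:
  "Vector_Spaces.linear scale scale T \<Longrightarrow> Vector_Spaces.linear scale scale (\<lambda>x. T x - x)"
proof -
  assume T: "Vector_Spaces.linear scale scale T"
  interpret T: Vector_Spaces.linear scale scale T by fact
  show ?thesis
    by unfold_locales (simp_all add: T.add T.scale scale_right_diff_distrib)
qed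

text \<open>The condition \<open>Q > 1\<close> puts \<open>1\<close> into the carrier
  \<open>{0..<Q}\<close>, so that it can serve as generator.\<close>

lemma cyclic_rep_generator:
  assumes \<rho>: "cyclic_rep Q scale \<rho>" and Q: "Q > 1"
  shows "Vector_Spaces.linear scale scale (\<rho> 1)"
    and "j < Q \<Longrightarrow> \<rho> (int j) = \<rho> 1 ^^ j"
    and "\<rho> 1 ^^ Q = id"
proof -
  have car: "int j \<in> carrier (integer_mod_group Q)" if "j < Q" for j
    using that by (simp add: carrier_integer_mod_group)
  have GL: "Vector_Spaces.linear scale scale (\<rho> (int j))" "bij (\<rho> (int j))" if "j < Q" for j
    using hom_in_carrier[OF \<rho>[unfolded cyclic_rep_def] car[OF that]]
    unfolding general_linear_group_def by auto
  have mult: "\<rho> (int ((i + j) mod Q)) = \<rho> (int i) \<circ> \<rho> (int j)" if "i < Q" "j < Q" for i j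
    using hom_mult[OF \<rho>[unfolded cyclic_rep_def] car[OF that(1)] car[OF that(2)]]
    unfolding general_linear_group_def by (simp add: zmod_int)
  show "Vector_Spaces.linear scale scale (\<rho> 1)" using GL(1)[of 1] Q by simp
  \<comment> \<open>\<open>\<rho> 0\<close> is an idempotent bijection.\<close>
  have 0: "\<rho> 0 = id"
  proof
    fix x
    have "\<rho> 0 (\<rho> 0 x) = \<rho> 0 x" using mult[of 0 0] Q by (metis add_0 mod_less o_apply of_nat_0 less_trans zero_less_one)
    then show "\<rho> 0 x = id x" using GL(2)[of 0] Q by (simp add: bij_def inj_eq)
  qed
  have pow: "\<rho> (int j) = \<rho> 1 ^^ j" if "j < Q" for j
    using that
  proof (induction j)
    case (Suc j)
    then show ?case using mult[of 1 j] Q by simp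
  qed (simp add: 0 id_def)
  then show "j < Q \<Longrightarrow> \<rho> (int j) = \<rho> 1 ^^ j" .
  have "\<rho> 1 ^^ Q = \<rho> 1 \<circ> \<rho> 1 ^^ (Q - 1)"
    using Q by (metis funpow.simps(2) Suc_pred' less_trans zero_less_one)
  also have "\<dots> = id" using mult[of 1 "Q - 1"] pow[of "Q - 1"] Q 0 by simp
  finally show "\<rho> 1 ^^ Q = id" .
qed

lemma subrep_iff:
  assumes \<rho>: "cyclic_rep Q scale \<rho>" and Q: "Q > 1"
  shows "subrep Q scale \<rho> W \<longleftrightarrow> subspace W \<and> (\<lambda>x. \<rho> 1 x - x) ` W \<subseteq> W"
proof (cases "subspace W")
  case True
  have one: "1 \<in> carrier (integer_mod_group Q)" using Q by (simp add: carrier_integer_mod_group)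
  have "(\<forall>g\<in>carrier (integer_mod_group Q). \<rho> g ` W \<subseteq> W) \<longleftrightarrow> \<rho> 1 ` W \<subseteq> W"
  proof
    assume W: "\<rho> 1 ` W \<subseteq> W"
    show "\<forall>g\<in>carrier (integer_mod_group Q). \<rho> g ` W \<subseteq> W"
    proof
      fix g assume "g \<in> carrier (integer_mod_group Q)"
      then have "g = int (nat g)" "nat g < Q" using Q by (auto simp: carrier_integer_mod_group)
      then have "\<rho> g = \<rho> 1 ^^ nat g" using cyclic_rep_generator(2)[OF \<rho> Q] by metis
      then show "\<rho> g ` W \<subseteq> W" using funpow_closed[OF W] by auto
    qed
  qed (use one in blast)
  also have "\<rho> 1 ` W \<subseteq> W \<longleftrightarrow> (\<lambda>x. \<rho> 1 x - x) ` W \<subseteq> W"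
  proof
    assume "\<rho> 1 ` W \<subseteq> W"
    then show "(\<lambda>x. \<rho> 1 x - x) ` W \<subseteq> W" using True by (auto intro: subspace_diff)
  next
    assume *: "(\<lambda>x. \<rho> 1 x - x) ` W \<subseteq> W"
    have "\<rho> 1 x \<in> W" if "x \<in> W" for x
      using subspace_add[OF True, of "\<rho> 1 x - x" x] * that by auto
    then show "\<rho> 1 ` W \<subseteq> W" by blast
  qed
  finally show ?thesis using True unfolding subrep_def by blast
qed (simp add: subrep_def)

lemma cyclic_rep_dims:
  assumes \<rho>: "cyclic_rep (p ^ n) scale \<rho>" and p: "prime p" "CHAR('a) = p" and "n > 0"
  shows "0 \<notin># indecomposable_dims (p ^ n) scale \<rho>"
    and "(\<Sum>d\<in>#indecomposable_dims (p ^ n) scale \<rho>. d - k) = dim (range ((\<lambda>x. \<rho> 1 x - x) ^^ k))"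
proof -
  have Q: "p ^ n > 1" using p(1) \<open>n > 0\<close> by (simp add: one_less_power prime_gt_1_nat del: One_nat_def)
  have T: "Vector_Spaces.linear scale scale (\<rho> 1)" by (rule cyclic_rep_generator[OF \<rho> Q])
  have "((\<lambda>x. \<rho> 1 x - x) ^^ (p ^ n)) x = 0" for x
    unfolding funpow_prime_power_minus[OF T p] cyclic_rep_generator(3)[OF \<rho> Q] by simp
  note * = indecomposable_dims_nilpotent[OF linear_minus_id[OF T] this subrep_iff[OF \<rho> Q]]
  show "0 \<notin># indecomposable_dims (p ^ n) scale \<rho>"
    "(\<Sum>d\<in>#indecomposable_dims (p ^ n) scale \<rho>. d - k) = dim (range ((\<lambda>x. \<rho> 1 x - x) ^^ k))"
    by (rule *)+
qed

text \<open>The generator of the subgroup acts by \<open>\<rho> 1 ^^ (p ^ r)\<close>, whose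
  difference with the identity is \<open>?N ^^ (p ^ r)\<close>. Its \<open>k\<close>-th power has
  the rank of \<open>?N ^^ (p ^ r * k)\<close>, which are the truncated sums of class sizes.\<close>

lemma sum_restricted_dims:
  fixes F :: "nat \<Rightarrow> 'c::comm_monoid_add"
  assumes \<rho>: "cyclic_rep (p ^ n) scale \<rho>" and p: "prime p" "CHAR('a) = p" and "r < n" and F: "F 0 = 0"
  shows "(\<Sum>d\<in>#indecomposable_dims (p ^ (n - r)) scale (restrict_rep p r \<rho>). F d) =
    (\<Sum>d\<in>#indecomposable_dims (p ^ n) scale \<rho>. \<Sum>a<p ^ r. F (progression_card (p ^ r) d a))"
proof -
  let ?N = "\<lambda>x. \<rho> 1 x - x"
  have p0: "p > 0" and n0: "n > 0" using p(1) \<open>r < n\<close> by (auto simp: prime_gt_0_nat)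
  have Q: "p ^ n > 1" using p(1) n0 by (simp add: one_less_power prime_gt_1_nat del: One_nat_def)
  have \<rho>': "cyclic_rep (p ^ (n - r)) scale (restrict_rep p r \<rho>)"
    by (rule cyclic_rep_restrict[OF \<rho> p0]) (use \<open>r < n\<close> in simp)
  have "p ^ r < p ^ n"
    using p(1) \<open>r < n\<close> by (intro power_strict_increasing prime_gt_1_nat)
  then have "restrict_rep p r \<rho> 1 = \<rho> 1 ^^ (p ^ r)"
    unfolding restrict_rep_def using cyclic_rep_generator(2)[OF \<rho> Q, of "p ^ r"] by simp
  then have N: "(\<lambda>x. restrict_rep p r \<rho> 1 x - x) = ?N ^^ (p ^ r)"
    using funpow_prime_power_minus[OF cyclic_rep_generator(1)[OF \<rho> Q] p] by (simp add: fun_eq_iff)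
  show ?thesis
  proof (rule sum_mset_progressions[of _ _ _ F, OF _ _ _ F])
    show "p ^ r > 0" using p0 by simp
    show "0 \<notin># indecomposable_dims (p ^ (n - r)) scale (restrict_rep p r \<rho>)"
      using cyclic_rep_dims(1)[OF \<rho>' p] \<open>r < n\<close> by simp
    show "(\<Sum>d\<in>#indecomposable_dims (p ^ (n - r)) scale (restrict_rep p r \<rho>). d - k) =
      (\<Sum>d\<in>#indecomposable_dims (p ^ n) scale \<rho>. d - p ^ r * k)" for k
      using cyclic_rep_dims(2)[OF \<rho>' p, of k] cyclic_rep_dims(2)[OF \<rho> p n0, of "p ^ r * k"] \<open>r < n\<close>
      unfolding N by (simp add: funpow_mult)
  qed
qed

end

section \<open>The v-function on all strata\<close>

lemma sum_digits: "(\<Sum>m<n. (x div p ^ m mod p) * p ^ m) = x mod p ^ n" for x p :: nat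
proof (induction n)
  case (Suc n)
  then show ?case using mod_mult2_eq[of x "p ^ n" p] by (simp add: mult.commute)
qed simp

lemma add_mult_div_eq: "a < P \<Longrightarrow> (a + q * P) div P = q" for a P q :: nat
  by simp

lemma digit_of_sum:
  fixes i :: "nat \<Rightarrow> nat"
  assumes "\<And>m. m < n \<Longrightarrow> i m < p" "k < n"
  shows "(\<Sum>m<n. i m * p ^ m) div p ^ k mod p = i k"
  using assms
proof (induction n arbitrary: i k)
  case (Suc n)
  have "(\<Sum>m<Suc n. i m * p ^ m) = i 0 + p * (\<Sum>m<n. i (Suc m) * p ^ m)"
    by (subst sum.lessThan_Suc_shift) (simp add: sum_distrib_left mult_ac)
  moreover have "i 0 < p" using Suc.prems(1)[of 0] by simp
  then have "(i 0 + p * X) div p = X" for X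
    using add_mult_div_eq[of "i 0" p X] by (simp add: mult.commute)
  ultimately show ?case
    using Suc.IH[of "\<lambda>m. i (Suc m)"] Suc.prems
    by (cases k) (auto simp: div_mult2_eq)
qed simp

text \<open>Tuples correspond to the numbers they are the digits of. The minimum appears because
  \<open>n\<close> digits only reach numbers below \<open>p ^ n\<close>.\<close>

lemma sum_digit_tuples:
  fixes G :: "(nat \<Rightarrow> nat) \<Rightarrow> 'c::comm_monoid_add"
  assumes "p > 0"
  shows "(\<Sum>i\<in>digit_tuples p n d. G i) =
    (\<Sum>x<min d (p ^ n). G (restrict (\<lambda>m. x div p ^ m mod p) {..<n}))"
proof (rule sum.reindex_bij_witness[of _ "\<lambda>x. restrict (\<lambda>m. x div p ^ m mod p) {..<n}"
      "\<lambda>i. \<Sum>m<n. i m * p ^ m"])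
  fix i assume i: "i \<in> digit_tuples p n d"
  then have "i \<in> {..<n} \<rightarrow>\<^sub>E {..<p}" and less: "(\<Sum>m<n. i m * p ^ m) < d"
    unfolding digit_tuples_def by auto
  then have lt: "i m < p" if "m < n" for m using that by auto
  show eq: "restrict (\<lambda>m. (\<Sum>m<n. i m * p ^ m) div p ^ m mod p) {..<n} = i"
    using \<open>i \<in> {..<n} \<rightarrow>\<^sub>E {..<p}\<close> digit_of_sum[of n i p] lt
    by (intro extensionalityI[of _ "{..<n}"]) (auto simp: PiE_def)
  have "(\<Sum>m<n. i m * p ^ m) = (\<Sum>m<n. i m * p ^ m) mod p ^ n"
    unfolding sum_digits[of "\<Sum>m<n. i m * p ^ m" p n, symmetric]
    using digit_of_sum[of n i p] lt by (intro sum.cong) auto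
  also have "\<dots> < p ^ n" using assms by simp
  finally show "(\<Sum>m<n. i m * p ^ m) \<in> {..<min d (p ^ n)}" using less by simp
  show "G (restrict (\<lambda>m. (\<Sum>m<n. i m * p ^ m) div p ^ m mod p) {..<n}) = G i"
    unfolding eq ..
next
  fix x assume x: "x \<in> {..<min d (p ^ n)}"
  have "(\<Sum>m<n. restrict (\<lambda>m. x div p ^ m mod p) {..<n} m * p ^ m) =
      (\<Sum>m<n. (x div p ^ m mod p) * p ^ m)" by (intro sum.cong) auto
  also have "\<dots> = x" using x by (simp add: sum_digits)
  finally show *: "(\<Sum>m<n. restrict (\<lambda>m. x div p ^ m mod p) {..<n} m * p ^ m) = x" .
  show "restrict (\<lambda>m. x div p ^ m mod p) {..<n} \<in> digit_tuples p n d"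
    unfolding digit_tuples_def mem_Collect_eq * using x assms by auto
qed

lemma digit_tuples_0 [simp]: "digit_tuples p n 0 = {}"
  by (simp add: digit_tuples_def)

section \<open>The v-function for arbitrary jump sequences\<close>

text \<open>The formula of \<open>v_indec\<close> with the lower jumps as a free argument, so that
  it also makes sense for the zero jumps of disconnected covers.\<close>

definition v_jumps :: "nat \<Rightarrow> nat \<Rightarrow> nat \<Rightarrow> (nat \<Rightarrow> int) \<Rightarrow> int" where
  "v_jumps p n d L =
     (\<Sum>i\<in>digit_tuples p n d.
        \<lceil>real_of_int (\<Sum>m<n. int (i m) * int p ^ (n - 1 - m) * L m) / real p ^ n\<rceil>)"

lemma v_jumps_0 [simp]: "v_jumps p n 0 L = 0"
  by (simp add: v_jumps_def)

lemma v_jumps_eq: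
  assumes "p > 0"
  shows "v_jumps p n d L = (\<Sum>x<min d (p ^ n).
    \<lceil>real_of_int (\<Sum>m<n. int (x div p ^ m mod p) * int p ^ (n - 1 - m) * L m) / real p ^ n\<rceil>)"
  unfolding v_jumps_def sum_digit_tuples[OF assms] by (intro sum.cong) auto

text \<open>Write \<open>x = a + q * p ^ r\<close>. The jumps ignore the \<open>r\<close> lowest
  digits, the other digits are those of \<open>q\<close>, and the factor \<open>p ^ r\<close> of the
  remaining jumps turns the denominator \<open>p ^ n\<close> into
  \<open>p ^ (n - r)\<close>.\<close>

lemma v_jumps_shift:
  assumes p: "p > 0" and r: "r < n"
    and L: "\<And>m. m < r \<Longrightarrow> L m = 0" "\<And>m. r + m < n \<Longrightarrow> L (r + m) = int p ^ r * L' m"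
  shows "(\<Sum>a<p ^ r. v_jumps p (n - r) (progression_card (p ^ r) d a) L') = v_jumps p n d L"
proof -
  let ?P = "p ^ r"
  define g where "g n L x =
    \<lceil>real_of_int (\<Sum>m<n. int (x div p ^ m mod p) * int p ^ (n - 1 - m) * L m) / real p ^ n\<rceil>"
    for n L x
  have P: "?P > 0" using p by simp
  have v: "v_jumps p n d L = (\<Sum>x<min d (p ^ n). g n L x)" for n d L
    unfolding v_jumps_eq[OF p] g_def ..
  have pn: "p ^ n = p ^ (n - r) * ?P" using r by (simp flip: power_add)
  have card: "progression_card ?P (min d (p ^ n)) a = min (progression_card ?P d a) (p ^ (n - r))"
    if a: "a < ?P" for a
  proof -
    have "q < progression_card ?P (min d (p ^ n)) a \<longleftrightarrow>
        q < min (progression_card ?P d a) (p ^ (n - r))" for q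
    proof -
      have "a + q * ?P < p ^ n \<longleftrightarrow> (a + q * ?P) div ?P < p ^ (n - r)"
        unfolding pn using P by (simp only: div_less_iff_less_mult)
      also have "(a + q * ?P) div ?P = q" using a by (rule add_mult_div_eq)
      finally show ?thesis by (simp add: less_progression_card_iff[OF P])
    qed
    then show ?thesis by (meson linorder_neqE_nat less_irrefl)
  qed
  have g: "g n L (a + q * ?P) = g (n - r) L' q" if a: "a < ?P" for a q
  proof -
    have "(\<Sum>m<n. int ((a + q * ?P) div p ^ m mod p) * int p ^ (n - 1 - m) * L m) =
        (\<Sum>m<r + (n - r). int ((a + q * ?P) div p ^ m mod p) * int p ^ (n - 1 - m) * L m)"
      using r by simp
    also have "\<dots> = (\<Sum>m<n - r. int ((a + q * ?P) div p ^ (r + m) mod p) * int p ^ (n - 1 - (r + m)) * L (r + m))"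
    proof -
      have "(\<Sum>m<r + k. f m) = (\<Sum>m<k. f (r + m))" if "\<And>m. m < r \<Longrightarrow> f m = 0"
        for k and f :: "nat \<Rightarrow> int"
        by (induction k) (use that in \<open>auto intro: sum.neutral\<close>)
      then show ?thesis using L(1) by simp
    qed
    also have "\<dots> = (\<Sum>m<n - r. int ?P * (int (q div p ^ m mod p) * int p ^ (n - r - 1 - m) * L' m))"
    proof (rule sum.cong)
      fix m assume "m \<in> {..<n - r}"
      then have "r + m < n" by simp
      have "(a + q * ?P) div p ^ (r + m) = (a + q * ?P) div ?P div p ^ m"
        by (simp add: power_add div_mult2_eq)
      then have "(a + q * ?P) div p ^ (r + m) = q div p ^ m" using add_mult_div_eq[OF a] by simp
      then show "int ((a + q * ?P) div p ^ (r + m) mod p) * int p ^ (n - 1 - (r + m)) * L (r + m) =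
          int ?P * (int (q div p ^ m mod p) * int p ^ (n - r - 1 - m) * L' m)"
        using L(2)[OF \<open>r + m < n\<close>] by (simp add: algebra_simps)
    qed simp
    also have "\<dots> = int ?P * (\<Sum>m<n - r. int (q div p ^ m mod p) * int p ^ (n - r - 1 - m) * L' m)"
      by (simp add: sum_distrib_left)
    finally have num: "(\<Sum>m<n. int ((a + q * ?P) div p ^ m mod p) * int p ^ (n - 1 - m) * L m) =
      int ?P * (\<Sum>m<n - r. int (q div p ^ m mod p) * int p ^ (n - r - 1 - m) * L' m)" .
    have "real p ^ n = real p ^ r * real p ^ (n - r)" using r by (simp flip: power_add)
    then show ?thesis unfolding g_def num using p by simp
  qed
  have "v_jumps p n d L = (\<Sum>a<?P. \<Sum>q<progression_card ?P (min d (p ^ n)) a. g n L (a + q * ?P))"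
    unfolding v by (rule sum_mod_classes[OF P])
  also have "\<dots> = (\<Sum>a<?P. \<Sum>q<min (progression_card ?P d a) (p ^ (n - r)). g (n - r) L' q)"
    using card g by (intro sum.cong) auto
  finally show ?thesis unfolding v by simp
qed

section \<open>Upper and lower jumps on all strata\<close>

text \<open>For \<open>P \<ge> 0\<close> this is the maximum of \<open>P ^ (i - m) * J m\<close>
  over \<open>m \<le> i\<close>, as a recursion that also gives the least sequence dominating
  \<open>J\<close> and growing at least by the factor \<open>P\<close>.\<close>

primrec max_jump :: "int \<Rightarrow> (nat \<Rightarrow> int) \<Rightarrow> nat \<Rightarrow> int" where
  "max_jump P J 0 = J 0"
| "max_jump P J (Suc i) = max (P * max_jump P J i) (J (Suc i))"

definition lower_of :: "int \<Rightarrow> (nat \<Rightarrow> int) \<Rightarrow> nat \<Rightarrow> int" where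
  "lower_of P u i = u 0 + (\<Sum>a=1..i. (u a - u (a - 1)) * P ^ a)"

lemma lower_of_0 [simp]: "lower_of P u 0 = u 0"
  by (simp add: lower_of_def)

lemma lower_of_Suc [simp]:
  "lower_of P u (Suc i) = lower_of P u i + (u (Suc i) - u i) * P ^ Suc i"
  by (simp add: lower_of_def)

text \<open>The first nonzero increment, at index \<open>r\<close>, has weight \<open>P ^ r\<close>;
  every later weight carries the same factor.\<close>

lemma lower_of_shift:
  assumes "\<And>m. m < r \<Longrightarrow> u m = 0"
  shows "lower_of P u (r + i) = P ^ r * lower_of P (\<lambda>i. u (r + i)) i"
proof (induction i)
  case 0
  have "lower_of P u m = 0" if "m < r" for m using that assms by (induction m) auto
  then show ?case using assms by (cases r) auto
qed (simp add: power_add algebra_simps)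

lemma lower_of_eq_0:
  assumes "\<And>m. m \<le> i \<Longrightarrow> u m = 0"
  shows "lower_of P u i = 0"
  using assms by (induction i) auto

lemma max_jump_eq_0:
  assumes "\<And>m. m \<le> i \<Longrightarrow> J m = 0"
  shows "max_jump P J i = 0"
  using assms by (induction i) auto

lemma max_jump_nonneg:
  assumes "P \<ge> 0" "\<And>m. m \<le> i \<Longrightarrow> J m \<ge> 0"
  shows "max_jump P J i \<ge> 0"
  using assms by (induction i) (auto simp: max_def)

text \<open>For positive \<open>r\<close> the recursion compares \<open>J r\<close> with
  \<open>P * 0\<close>, and \<open>J r \<ge> 0\<close> makes \<open>J r\<close> the new starting
  value.\<close>

lemma max_jump_shift:
  assumes "\<And>m. m < r \<Longrightarrow> J m = 0" "J r \<ge> 0"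
  shows "max_jump P J (r + i) = max_jump P (\<lambda>i. J (r + i)) i"
proof (induction i)
  case 0
  show ?case
  proof (cases r)
    case (Suc s)
    then have "max_jump P J s = 0" using assms(1) by (intro max_jump_eq_0) auto
    then show ?thesis using Suc assms(2) by simp
  qed simp
qed simp

text \<open>Zero components are omitted on the left and count as 0 on the right. This is harmless
  because the component at 0 keeps the set nonempty and the maximum is nonnegative.\<close>

lemma upper_jump_eq_max_jump:
  assumes "p > 0" "fs ! 0 \<noteq> 0"
    and J: "\<And>m. m \<le> i \<Longrightarrow> J m = (if fs ! m = 0 then 0 else - fls_subdegree (fs ! m))"
      "\<And>m. m \<le> i \<Longrightarrow> J m \<ge> 0"
  shows "upper_jump p fs i = max_jump (int p) J i"
  using J
proof (induction i)
  case 0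
  have "{int p ^ (0 - m) * - fls_subdegree (fs ! m) |m. m \<le> 0 \<and> fs ! m \<noteq> 0} = {- fls_subdegree (fs ! 0)}"
    using assms(2) by auto
  then show ?case using 0 assms(2) unfolding upper_jump_def by simp
next
  case (Suc i)
  define A where "A i = {int p ^ (i - m) * - fls_subdegree (fs ! m) |m. m \<le> i \<and> fs ! m \<noteq> 0}" for i
  have IH: "Max (A i) = max_jump (int p) J i"
    using Suc unfolding A_def upper_jump_def by simp
  have A_image: "A i = (\<lambda>m. int p ^ (i - m) * - fls_subdegree (fs ! m)) ` {m. m \<le> i \<and> fs ! m \<noteq> 0}" for i
    unfolding A_def by blast
  have fin: "finite (A i)" for i unfolding A_image by simp
  have ne: "A i \<noteq> {}" for i unfolding A_image using assms(2) by auto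
  have "A (Suc i) = (\<lambda>x. int p * x) ` A i \<union> (if fs ! Suc i = 0 then {} else {J (Suc i)})"
  proof -
    have "{m. m \<le> Suc i \<and> fs ! m \<noteq> 0} =
        {m. m \<le> i \<and> fs ! m \<noteq> 0} \<union> (if fs ! Suc i = 0 then {} else {Suc i})"
      by (auto simp: le_Suc_eq)
    then have "A (Suc i) =
        (\<lambda>m. int p ^ (Suc i - m) * - fls_subdegree (fs ! m)) ` {m. m \<le> i \<and> fs ! m \<noteq> 0} \<union>
        (if fs ! Suc i = 0 then {} else {J (Suc i)})"
      unfolding A_image using Suc.prems(1)[of "Suc i"] by auto
    also have "(\<lambda>m. int p ^ (Suc i - m) * - fls_subdegree (fs ! m)) ` {m. m \<le> i \<and> fs ! m \<noteq> 0} =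
        (\<lambda>x. int p * x) ` A i"
      unfolding A_image image_image by (intro image_cong) (auto simp: Suc_diff_le)
    finally show ?thesis .
  qed
  moreover have "Max ((\<lambda>x. int p * x) ` A i) = int p * max_jump (int p) J i"
    unfolding IH[symmetric]
    by (rule mono_Max_commute[symmetric]) (auto simp: mono_def fin ne intro: mult_left_mono)
  moreover have "max_jump (int p) J i \<ge> 0" using Suc.prems(2) by (intro max_jump_nonneg) auto
  ultimately have "Max (A (Suc i)) = max_jump (int p) J (Suc i)"
    using fin[of i] ne[of i] Suc.prems(1)[of "Suc i"] by (auto simp: Max_insert max.commute)
  then show ?case unfolding A_def upper_jump_def .
qed

lemma lower_jump_eq: "lower_jump p fs i = lower_of (int p) (upper_jump p fs) i"
  unfolding lower_jump_def lower_of_def ..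

lemma lower_of_cong:
  assumes "\<And>m. m \<le> i \<Longrightarrow> u m = u' m"
  shows "lower_of P u i = lower_of P u' i"
  using assms by (induction i) auto

definition pole_order :: "nat option list \<Rightarrow> nat \<Rightarrow> int" where
  "pole_order js m = (case js ! m of None \<Rightarrow> 0 | Some j \<Rightarrow> int j)"

lemma pole_order_nonneg [simp]: "pole_order js m \<ge> 0"
  by (simp add: pole_order_def split: option.split)

lemma v_jumps_cong:
  assumes "\<And>m. m < n \<Longrightarrow> L m = L' m"
  shows "v_jumps p n d L = v_jumps p n d L'"
proof -
  have "(\<Sum>m<n. int (i m) * int p ^ (n - 1 - m) * L m) = (\<Sum>m<n. int (i m) * int p ^ (n - 1 - m) * L' m)"
    for i using assms by (intro sum.cong) auto
  then show ?thesis unfolding v_jumps_def by simp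
qed

text \<open>If \<open>r\<close> is the first nonzero component, the jumps vanish before
  \<open>r\<close> and are \<open>p ^ r\<close> times those of the connected component afterwards,
  while restriction cuts each block into residue classes modulo \<open>p ^ r\<close>. By
  \<open>v_jumps_shift\<close> these two effects cancel.\<close>

lemma v_fun_eq:
  fixes scale :: "'k::field \<Rightarrow> 'v::ab_group_add \<Rightarrow> 'v"
  assumes fd: "finite_dimensional_vector_space scale Basis"
    and \<rho>: "cyclic_rep (p ^ n) scale \<rho>" and p: "prime p" "CHAR('k) = p"
    and js: "js \<in> strata_indices p n" and E: "E \<in> GCov_stratum p js"
  shows "v_fun p n scale \<rho> E =
    (\<Sum>d\<in>#indecomposable_dims (p ^ n) scale \<rho>.
       v_jumps p n d (lower_of (int p) (max_jump (int p) (pole_order js))))"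
proof -
  interpret finite_dimensional_vector_space scale Basis by fact
  let ?J = "pole_order js"
  have p0: "p > 0" using p(1) by (simp add: prime_gt_0_nat)
  have len: "length js = n" "length E = n"
    using js E unfolding strata_indices_def GCov_stratum_def by auto
  have J: "?J m = (if E ! m = 0 then 0 else - fls_subdegree (E ! m))" if "m < n" for m
    using E that len unfolding GCov_stratum_def pole_order_def by (auto split: option.splits)
  have subdeg: "fls_subdegree (E ! m) \<le> 0" if "m < n" "E ! m \<noteq> 0" for m
    using J[OF that(1)] that(2) pole_order_nonneg[of js m] by simp
  define r where "r = length (takeWhile (\<lambda>f. f = 0) E)"
  have r: "r \<le> n" unfolding r_def using length_takeWhile_le[of _ E] len by simp
  have below: "?J m = 0" if "m < r" for m
    using J[of m] that r nth_mem[of m "takeWhile (\<lambda>f. f = 0) E"] takeWhile_nth[of m "\<lambda>f. f = 0" E]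
      set_takeWhileD[of "E ! m" "\<lambda>f. f = 0" E] unfolding r_def by auto
  show ?thesis
  proof (cases "r = n")
    case True
    have "v_jumps p n d (lower_of (int p) (max_jump (int p) ?J)) = v_jumps p n d (\<lambda>_. 0)" for d
      using below True by (intro v_jumps_cong lower_of_eq_0 max_jump_eq_0) auto
    then show ?thesis using True unfolding v_fun_def r_def by (simp add: v_jumps_def)
  next
    case False
    then have rn: "r < n" using r by simp
    have "E ! r \<noteq> 0"
      using nth_length_takeWhile[of "\<lambda>f. f = 0" E] rn len unfolding r_def by simp
    then have nz: "drop r E ! 0 \<noteq> 0" using rn len by simp
    have lower: "lower_of (int p) (max_jump (int p) ?J) (r + m) = int p ^ r * lower_jump p (drop r E) m"
      if m: "r + m < n" for m
    proof -
      have "upper_jump p (drop r E) i = max_jump (int p) ?J (r + i)" if "i \<le> m" for i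
      proof -
        have "max_jump (int p) ?J (r + i) = max_jump (int p) (\<lambda>i. ?J (r + i)) i"
          using below by (intro max_jump_shift) auto
        also have "\<dots> = upper_jump p (drop r E) i"
          using that m J subdeg rn len by (intro upper_jump_eq_max_jump[symmetric] p0 nz) auto
        finally show ?thesis by simp
      qed
      then have "lower_jump p (drop r E) m = lower_of (int p) (\<lambda>i. max_jump (int p) ?J (r + i)) m"
        unfolding lower_jump_eq by (rule lower_of_cong)
      then show ?thesis
        using below by (subst lower_of_shift) (auto intro: max_jump_eq_0)
    qed
    have low0: "lower_of (int p) (max_jump (int p) ?J) m = 0" if "m < r" for m
      using below that by (intro lower_of_eq_0 max_jump_eq_0) auto
    have "v_fun p n scale \<rho> E =
        (\<Sum>d\<in>#indecomposable_dims (p ^ (n - r)) scale (restrict_rep p r \<rho>).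
           v_jumps p (n - r) d (lower_jump p (drop r E)))"
      using False unfolding v_fun_def v_connected_def v_indec_def v_jumps_def r_def by (simp add: Let_def)
    also have "\<dots> = (\<Sum>d\<in>#indecomposable_dims (p ^ n) scale \<rho>. \<Sum>a<p ^ r.
        v_jumps p (n - r) (progression_card (p ^ r) d a) (lower_jump p (drop r E)))"
      by (rule sum_restricted_dims[OF \<rho> p rn]) simp
    also have "\<dots> = (\<Sum>d\<in>#indecomposable_dims (p ^ n) scale \<rho>.
        v_jumps p n d (lower_of (int p) (max_jump (int p) ?J)))"
      using v_jumps_shift[of p r n "lower_of (int p) (max_jump (int p) ?J)"
          "lower_jump p (drop r E)", OF p0 rn low0 lower] by simp
    finally show ?thesis .
  qed
qed

section \<open>Dimensions of the terms\<close>

text \<open>Summation by parts.\<close>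

lemma lower_of_expand:
  "lower_of P u m = u m * P ^ m + (\<Sum>a<m. u a * (P ^ a - P ^ Suc a))"
  by (induction m) (simp_all add: algebra_simps)

lemma sum_triangle_swap:
  fixes f :: "nat \<Rightarrow> nat \<Rightarrow> 'a::comm_monoid_add"
  shows "(\<Sum>m<n. \<Sum>a<m. f m a) = (\<Sum>a<n. \<Sum>m=a+1..n-1. f m a)"
proof -
  have "(\<Sum>m<n. \<Sum>a<m. f m a) = (\<Sum>(m, a)\<in>(SIGMA m:{..<n}. {..<m}). f m a)"
    by (simp add: sum.Sigma)
  also have "\<dots> = (\<Sum>(a, m)\<in>(SIGMA a:{..<n}. {a+1..n-1}). f m a)"
    by (rule sum.reindex_bij_witness[of _ "\<lambda>(a, m). (m, a)" "\<lambda>(m, a). (a, m)"]) auto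
  finally show ?thesis by (simp add: sum.Sigma)
qed

text \<open>The origin of \<open>D_indec\<close>: it is the coefficient of the upper jump
  \<open>u a\<close> once the lower jumps are expressed through the upper ones.\<close>

lemma sum_lower_of_eq_D_indec:
  assumes "p > 0"
  shows "(\<Sum>m<n. real (S_inv p n d m) * real p ^ (n - 1 - m) * real_of_int (lower_of (int p) u m)) =
    (\<Sum>a<n. real_of_int (u a) * D_indec p n d a)"
proof -
  let ?S = "\<lambda>m. real (S_inv p n d m)"
  let ?p = "real p"
  have "(\<Sum>m<n. ?S m * ?p ^ (n - 1 - m) * real_of_int (lower_of (int p) u m)) =
      (\<Sum>m<n. ?S m * ?p ^ (n - 1 - m) * (real_of_int (u m) * ?p ^ m)) +
      (\<Sum>m<n. \<Sum>a<m. ?S m * ?p ^ (n - 1 - m) * (real_of_int (u a) * (?p ^ a - ?p ^ Suc a)))"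
    by (simp add: lower_of_expand distrib_left sum.distrib sum_distrib_left)
  also have "(\<Sum>m<n. ?S m * ?p ^ (n - 1 - m) * (real_of_int (u m) * ?p ^ m)) =
      (\<Sum>m<n. real_of_int (u m) * (?p ^ (n - 1) * ?S m))"
  proof (rule sum.cong)
    fix m assume "m \<in> {..<n}"
    then have "?p ^ (n - 1) = ?p ^ (n - 1 - m) * ?p ^ m" by (simp flip: power_add)
    then show "?S m * ?p ^ (n - 1 - m) * (real_of_int (u m) * ?p ^ m) =
        real_of_int (u m) * (?p ^ (n - 1) * ?S m)" by simp
  qed simp
  also have "(\<Sum>m<n. \<Sum>a<m. ?S m * ?p ^ (n - 1 - m) * (real_of_int (u a) * (?p ^ a - ?p ^ Suc a))) =
      (\<Sum>a<n. \<Sum>m=a+1..n-1. ?S m * ?p ^ (n - 1 - m) * (real_of_int (u a) * (?p ^ a - ?p ^ Suc a)))"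
    by (rule sum_triangle_swap)
  also have "\<dots> = (\<Sum>a<n. \<Sum>m=a+1..n-1.
      - (real_of_int (u a) * (?p ^ (n - 1) * ((?p - 1) * (?p powi (int a - int m) * ?S m)))))"
  proof (intro sum.cong refl)
    fix a m assume am: "a \<in> {..<n}" "m \<in> {a+1..n-1}"
    \<comment> \<open>The exponent \<open>int a - int m\<close> is negative; the factor
      \<open>?p ^ (n - 1)\<close> makes the total exponent a natural number.\<close>
    have "?p ^ (n - 1) * ?p powi (int a - int m) = ?p powi (int (n - 1) + (int a - int m))"
      using assms by (simp add: power_int_add flip: power_int_of_nat)
    also have "int (n - 1) + (int a - int m) = int (n - 1 - m + a)"
      using am by auto
    also have "?p powi \<dots> = ?p ^ (n - 1 - m) * ?p ^ a"
      unfolding power_int_of_nat by (rule power_add)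
    finally have *: "?p ^ (n - 1) * ?p powi (int a - int m) = ?p ^ (n - 1 - m) * ?p ^ a" .
    have "real_of_int (u a) * (?p ^ (n - 1) * ((?p - 1) * (?p powi (int a - int m) * ?S m))) =
      real_of_int (u a) * ((?p - 1) * ((?p ^ (n - 1) * ?p powi (int a - int m)) * ?S m))"
      by (simp only: mult_ac)
    then show "?S m * ?p ^ (n - 1 - m) * (real_of_int (u a) * (?p ^ a - ?p ^ Suc a)) =
        - (real_of_int (u a) * (?p ^ (n - 1) * ((?p - 1) * (?p powi (int a - int m) * ?S m))))"
      unfolding * by (simp add: algebra_simps)
  qed
  finally show ?thesis
    unfolding D_indec_def
    by (simp add: sum_negf right_diff_distrib sum_subtractf sum_distrib_left)
qed

lemma finite_digit_tuples [simp]: "finite (digit_tuples p n d)"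
  unfolding digit_tuples_def by (rule finite_subset[OF _ finite_PiE[of "{..<n}" "\<lambda>_. {..<p}"]]) auto

text \<open>Without the ceilings the sum is exactly the linear form in \<open>u\<close>; each
  ceiling adds at most 1.\<close>

lemma v_jumps_bounds:
  assumes "p > 0"
  shows "(\<Sum>a<n. real_of_int (u a) * D_indec p n d a) / real p ^ n \<le>
      real_of_int (v_jumps p n d (lower_of (int p) u))"
    and "real_of_int (v_jumps p n d (lower_of (int p) u)) \<le>
      (\<Sum>a<n. real_of_int (u a) * D_indec p n d a) / real p ^ n + real (card (digit_tuples p n d))"
proof -
  let ?x = "\<lambda>i. real_of_int (\<Sum>m<n. int (i m) * int p ^ (n - 1 - m) * lower_of (int p) u m) / real p ^ n"
  have "(\<Sum>i\<in>digit_tuples p n d. ?x i) =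
      (\<Sum>i\<in>digit_tuples p n d. \<Sum>m<n. real (i m) * real p ^ (n - 1 - m) *
         real_of_int (lower_of (int p) u m)) / real p ^ n"
    by (simp add: sum_divide_distrib)
  also have "(\<Sum>i\<in>digit_tuples p n d. \<Sum>m<n. real (i m) * real p ^ (n - 1 - m) *
         real_of_int (lower_of (int p) u m)) =
      (\<Sum>m<n. real (S_inv p n d m) * real p ^ (n - 1 - m) * real_of_int (lower_of (int p) u m))"
    by (subst sum.swap) (simp add: S_inv_def sum_distrib_right)
  finally have *: "(\<Sum>i\<in>digit_tuples p n d. ?x i) =
      (\<Sum>a<n. real_of_int (u a) * D_indec p n d a) / real p ^ n"
    unfolding sum_lower_of_eq_D_indec[OF assms] .
  have v: "real_of_int (v_jumps p n d (lower_of (int p) u)) =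
      (\<Sum>i\<in>digit_tuples p n d. real_of_int \<lceil>?x i\<rceil>)"
    unfolding v_jumps_def by simp
  show "(\<Sum>a<n. real_of_int (u a) * D_indec p n d a) / real p ^ n \<le>
      real_of_int (v_jumps p n d (lower_of (int p) u))"
    unfolding v *[symmetric] by (intro sum_mono le_of_int_ceiling)
  have "(\<Sum>i\<in>digit_tuples p n d. real_of_int \<lceil>?x i\<rceil>) \<le> (\<Sum>i\<in>digit_tuples p n d. ?x i + 1)"
    by (intro sum_mono of_int_ceiling_le_add_one)
  then show "real_of_int (v_jumps p n d (lower_of (int p) u)) \<le>
      (\<Sum>a<n. real_of_int (u a) * D_indec p n d a) / real p ^ n + real (card (digit_tuples p n d))"
    unfolding v *[symmetric] by (simp add: sum.distrib)
qed

lemma sum_mset_v_jumps_bounds: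
  fixes M :: "nat multiset" and n :: nat and u :: "nat \<Rightarrow> int"
  assumes "p > 0"
  defines "V \<equiv> real_of_int (\<Sum>d\<in>#M. v_jumps p n d (lower_of (int p) u))"
    and "X \<equiv> (\<Sum>a<n. real_of_int (u a) * (\<Sum>d\<in>#M. D_indec p n d a)) / real p ^ n"
  shows "X \<le> V" "V \<le> X + real (\<Sum>d\<in>#M. card (digit_tuples p n d))"
proof -
  have "X \<le> V \<and> V \<le> X + real (\<Sum>d\<in>#M. card (digit_tuples p n d))"
    unfolding V_def X_def
  proof (induction M)
    case (add d M)
    then show ?case
      using v_jumps_bounds[OF assms(1), where n = n and d = d and u = u]
      by (simp add: distrib_left sum.distrib add_divide_distrib)
  qed simp
  then show "X \<le> V" "V \<le> X + real (\<Sum>d\<in>#M. card (digit_tuples p n d))" by auto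
qed

text \<open>Replacing \<open>j div p\<close> by \<open>j / p\<close> changes each component by at
  most 1, and \<open>None\<close> contributes 0 throughout.\<close>

lemma stratum_dim_bounds:
  assumes "length js = n" "p > 0"
  shows "(1 - 1 / real p) * (\<Sum>m<n. real_of_int (pole_order js m)) \<le> real_of_int (stratum_dim p js)"
    and "real_of_int (stratum_dim p js) \<le> (1 - 1 / real p) * (\<Sum>m<n. real_of_int (pole_order js m)) + real n"
proof -
  have s: "real_of_int (stratum_dim p js) =
      (\<Sum>m<n. real_of_int (case js ! m of None \<Rightarrow> 0 | Some j \<Rightarrow> int j - int (j div p)))"
    unfolding stratum_dim_def assms(1) by simp
  have b: "(1 - 1 / real p) * real_of_int (pole_order js m) \<le>
        real_of_int (case js ! m of None \<Rightarrow> 0 | Some j \<Rightarrow> int j - int (j div p)) \<and>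
      real_of_int (case js ! m of None \<Rightarrow> 0 | Some j \<Rightarrow> int j - int (j div p)) \<le>
        (1 - 1 / real p) * real_of_int (pole_order js m) + 1" for m
  proof (cases "js ! m")
    case (Some j)
    have "real j = real p * real (j div p) + real (j mod p)"
      by (simp flip: of_nat_mult of_nat_add)
    moreover have "real (j mod p) < real p" using assms(2) by simp
    ultimately have "real (j div p) \<le> real j / real p" "real j / real p \<le> real (j div p) + 1"
      using assms(2) by (simp_all add: field_simps)
    then show ?thesis using Some by (simp add: pole_order_def left_diff_distrib)
  qed (simp add: pole_order_def)
  show "(1 - 1 / real p) * (\<Sum>m<n. real_of_int (pole_order js m)) \<le> real_of_int (stratum_dim p js)"
    unfolding s sum_distrib_left using b by (intro sum_mono) blast
  have "real_of_int (stratum_dim p js) \<le> (\<Sum>m<n. (1 - 1 / real p) * real_of_int (pole_order js m) + 1)"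
    unfolding s using b by (intro sum_mono) blast
  then show "real_of_int (stratum_dim p js) \<le> (1 - 1 / real p) * (\<Sum>m<n. real_of_int (pole_order js m)) + real n"
    by (simp add: sum.distrib sum_distrib_left)
qed

section \<open>Ray coordinates on the cone of upper jumps\<close>

text \<open>The coordinates of \<open>u\<close> with respect to the rays
  \<open>(0, ..., 0, 1, P, P^2, ...)\<close> with first nonzero entry at \<open>m\<close>. They are
  nonnegative on the cone of possible jumps.\<close>

definition jump_excess :: "int \<Rightarrow> (nat \<Rightarrow> int) \<Rightarrow> nat \<Rightarrow> int" where
  "jump_excess P u m = (if m = 0 then u 0 else u m - P * u (m - 1))"

lemma jump_eq_sum_excess: "u l = (\<Sum>m\<le>l. P ^ (l - m) * jump_excess P u m)"
proof (induction l)
  case (Suc l)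
  have "(\<Sum>m\<le>Suc l. P ^ (Suc l - m) * jump_excess P u m) =
      (\<Sum>m\<le>l. P * (P ^ (l - m) * jump_excess P u m)) + jump_excess P u (Suc l)"
    by (simp add: Suc_diff_le mult.assoc)
  also have "\<dots> = P * u l + jump_excess P u (Suc l)"
    unfolding Suc.IH by (simp add: sum_distrib_left)
  finally show ?case by (simp add: jump_excess_def)
qed (simp add: jump_excess_def)

lemma jump_excess_max_jump_nonneg:
  "(\<And>m. J m \<ge> 0) \<Longrightarrow> jump_excess P (max_jump P J) m \<ge> 0"
  by (cases m) (auto simp: jump_excess_def)

lemma le_max_jump: "J m \<le> max_jump P J m"
  by (cases m) auto

text \<open>A linear form in ray coordinates: the inner sum is its value on the \<open>m\<close>-th
  ray.\<close>

lemma sum_jumps_eq_sum_excess: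
  fixes g :: "nat \<Rightarrow> real"
  shows "(\<Sum>l<n. real_of_int (u l) * g l) =
    (\<Sum>m<n. real_of_int (jump_excess P u m) * (\<Sum>l=m..n-1. real_of_int P ^ (l - m) * g l))"
proof -
  let ?w = "\<lambda>m. real_of_int (jump_excess P u m)"
  have "(\<Sum>l<n. real_of_int (u l) * g l) =
      (\<Sum>l<n. \<Sum>m\<le>l. ?w m * (real_of_int P ^ (l - m) * g l))"
    by (subst jump_eq_sum_excess[of u _ P]) (simp add: sum_distrib_right sum_distrib_left mult_ac)
  also have "\<dots> = (\<Sum>(l, m)\<in>(SIGMA l:{..<n}. {..l}). ?w m * (real_of_int P ^ (l - m) * g l))"
    by (simp add: sum.Sigma)
  also have "\<dots> = (\<Sum>(m, l)\<in>(SIGMA m:{..<n}. {m..n-1}). ?w m * (real_of_int P ^ (l - m) * g l))"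
    by (rule sum.reindex_bij_witness[of _ "\<lambda>(a, m). (m, a)" "\<lambda>(m, a). (a, m)"]) auto
  finally show ?thesis by (simp add: sum.Sigma sum_distrib_left)
qed

text \<open>On the \<open>m\<close>-th ray the approximate dimension is a positive multiple of the
  left-hand side of the \<open>m\<close>-th inequality; its constant part is a geometric
  sum.\<close>

lemma sum_excess_coefficient:
  fixes D :: "nat \<Rightarrow> real"
  assumes p: "p > 1" and m: "m < n"
  shows "(\<Sum>l=m..n-1. real p ^ (l - m) * ((1 - 1 / real p) - D l / real p ^ n)) =
    real p ^ (n - 1 - m) * (1 - 1 / real p ^ (n - m) - (\<Sum>l=m..n-1. D l / real p ^ (2 * n - 1 - l)))"
proof -
  let ?p = "real p"
  have "(\<Sum>l=m..n-1. ?p ^ (l - m)) = (\<Sum>i<n - m. ?p ^ i)"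
    by (rule sum.reindex_bij_witness[of _ "\<lambda>i. i + m" "\<lambda>l. l - m"]) (use m in auto)
  also have "\<dots> = (?p ^ (n - m) - 1) / (?p - 1)" using p by (simp add: geometric_sum)
  finally have "(\<Sum>l=m..n-1. ?p ^ (l - m)) * (1 - 1 / ?p) = (?p ^ (n - m) - 1) / (?p - 1) * (1 - 1 / ?p)"
    by simp
  also have "\<dots> = (?p ^ (n - m) - 1) / ?p" using p by (simp add: field_simps)
  also have "\<dots> = ?p ^ (n - 1 - m) * (1 - 1 / ?p ^ (n - m))"
  proof -
    have "?p ^ (n - m) = ?p * ?p ^ (n - 1 - m)" using m by (simp flip: power_Suc add: Suc_diff_Suc)
    then show ?thesis using p by (simp add: field_simps)
  qed
  finally have 1: "(\<Sum>l=m..n-1. ?p ^ (l - m)) * (1 - 1 / ?p) = ?p ^ (n - 1 - m) * (1 - 1 / ?p ^ (n - m))" .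
  have 2: "?p ^ (l - m) * (D l / ?p ^ n) = ?p ^ (n - 1 - m) * (D l / ?p ^ (2 * n - 1 - l))"
    if l: "l \<in> {m..n-1}" for l
  proof -
    have "l - m + (2 * n - 1 - l) = n - 1 - m + n" using l m by auto
    then have "?p ^ (l - m) * ?p ^ (2 * n - 1 - l) = ?p ^ (n - 1 - m) * ?p ^ n"
      by (simp flip: power_add)
    then show ?thesis using p by (simp add: field_simps)
  qed
  have "(\<Sum>l=m..n-1. ?p ^ (l - m) * ((1 - 1 / ?p) - D l / ?p ^ n)) =
      (\<Sum>l=m..n-1. ?p ^ (l - m)) * (1 - 1 / ?p) - (\<Sum>l=m..n-1. ?p ^ (l - m) * (D l / ?p ^ n))"
    by (simp only: right_diff_distrib sum_subtractf sum_distrib_right)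
  also have "(\<Sum>l=m..n-1. ?p ^ (l - m) * (D l / ?p ^ n)) =
      ?p ^ (n - 1 - m) * (\<Sum>l=m..n-1. D l / ?p ^ (2 * n - 1 - l))"
    unfolding sum_distrib_left by (intro sum.cong 2) auto
  finally show ?thesis unfolding 1 by (simp only: right_diff_distrib)
qed

section \<open>Strata close to the rays\<close>

text \<open>Monomials \<open>t^(-j)\<close> serve as components. Divergence needs an actual cover,
  since the set in \<open>integral_converges\<close> asks for one.\<close>

lemma GCov_stratum_nonempty:
  assumes "js \<in> strata_indices p n"
  shows "\<exists>E :: 'k::field fls list. E \<in> GCov_stratum p js"
proof -
  define E :: "'k fls list" where
    "E = map (\<lambda>x. case x of None \<Rightarrow> 0 | Some j \<Rightarrow> fls_X_intpow (- int j)) js"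
  have "reduced_fls p (E ! m) \<and> (case js ! m of None \<Rightarrow> E ! m = 0
      | Some j \<Rightarrow> E ! m \<noteq> 0 \<and> fls_subdegree (E ! m) = - int j)" if m: "m < length js" for m
  proof (cases "js ! m")
    case (Some j)
    then have "Some j \<in> set js" using m nth_mem by metis
    then have "0 < j" "\<not> p dvd j" using assms unfolding strata_indices_def by auto
    have "fls_nth (fls_X_intpow (- int j) :: 'k fls) (- int j) = 1" by simp
    then have "fls_X_intpow (- int j) \<noteq> (0 :: 'k fls)" by (metis fls_zero_nth zero_neq_one)
    moreover have "reduced_fls p (fls_X_intpow (- int j) :: 'k fls)"
      unfolding reduced_fls_def
    proof (intro allI impI)
      fix i assume "fls_nth (fls_X_intpow (- int j) :: 'k fls) i \<noteq> 0"
      then have "i = - int j" by (auto split: if_splits)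
      then show "i < 0 \<and> \<not> int p dvd i" using \<open>0 < j\<close> \<open>\<not> p dvd j\<close> by simp
    qed
    ultimately show ?thesis using Some m unfolding E_def by simp
  qed (use m in \<open>simp add: E_def reduced_fls_def\<close>)
  moreover have "length E = length js" by (simp add: E_def)
  ultimately have "E \<in> GCov_stratum p js" unfolding GCov_stratum_def by simp
  then show ?thesis ..
qed

text \<open>Pole orders near \<open>j\<close> times the \<open>m\<close>-th ray. The later entries
  of the ray are divisible by \<open>p\<close>, so they are lowered by 1.\<close>

definition ray_index :: "nat \<Rightarrow> nat \<Rightarrow> nat \<Rightarrow> nat \<Rightarrow> nat option list" where
  "ray_index p n m j = map (\<lambda>l. if l < m then None else if l = m then Some j
     else Some (p ^ (l - m) * j - 1)) [0..<n]"

lemma ray_index_in_strata: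
  assumes "p > 1" "\<not> p dvd j"
  shows "ray_index p n m j \<in> strata_indices p n"
proof -
  have j: "j > 0" using assms by (intro Nat.gr0I) auto
  have "0 < i \<and> \<not> p dvd i" if "Some i \<in> set (ray_index p n m j)" for i
  proof -
    obtain l where l: "i = j \<or> (l > m \<and> i = p ^ (l - m) * j - 1)"
    proof -
      obtain l where "Some i = (if l < m then None else if l = m then Some j
          else Some (p ^ (l - m) * j - 1))"
        using \<open>Some i \<in> set _\<close> unfolding ray_index_def set_map by blast
      then show thesis using that[of l] by (auto split: if_splits)
    qed
    then show ?thesis
    proof
      assume i: "l > m \<and> i = p ^ (l - m) * j - 1"
      \<comment> \<open>Exceeding 1 keeps the lowered entry positive and the natural subtraction
        exact.\<close>
      have "1 < p ^ (l - m)" using assms(1) i by (simp add: one_less_power del: One_nat_def)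
      also have "p ^ (l - m) \<le> p ^ (l - m) * j" using j by simp
      finally have gt: "1 < p ^ (l - m) * j" .
      have "p dvd p ^ (l - m) * j" using i by (simp add: dvd_power)
      moreover have "p ^ (l - m) * j = i + 1" using i gt by simp
      ultimately have "p dvd i + 1" by simp
      then have "\<not> p dvd i" using assms(1) dvd_add_right_iff[of p i 1] by auto
      then show ?thesis using gt i by simp
    qed (use assms j in auto)
  qed
  then show ?thesis unfolding strata_indices_def by (simp add: ray_index_def)
qed

text \<open>After position \<open>m\<close>, \<open>p\<close> times the previous jump exceeds the
  pole order by 1 and wins the maximum, so the jumps lie exactly on the ray.\<close>

lemma max_jump_ray_index:
  assumes "p > 0" "j > 0" "l < n"
  shows "max_jump (int p) (pole_order (ray_index p n m j)) l = (if l < m then 0 else int (p ^ (l - m) * j))"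
  using assms(3)
proof (induction l)
  case (Suc l)
  have IH: "max_jump (int p) (pole_order (ray_index p n m j)) l =
      (if l < m then 0 else int (p ^ (l - m) * j))"
    using Suc by simp
  have J: "pole_order (ray_index p n m j) (Suc l) = (if Suc l < m then 0 else if Suc l = m then int j
      else int (p ^ (Suc l - m) * j - 1))"
    using Suc.prems by (simp add: ray_index_def pole_order_def)
  consider "Suc l < m" | "Suc l = m" | "m \<le> l" by linarith
  then show ?case
  proof cases
    case 3
    then have "int p * int (p ^ (l - m) * j) = int (p ^ (Suc l - m) * j)"
      by (simp add: Suc_diff_le)
    moreover have "(l < m) = False" "(Suc l < m) = False" "(Suc l = m) = False" using 3 by auto
    ultimately show ?thesis
      by (simp only: max_jump.simps IH J if_False max.absorb1 of_nat_le_iff diff_le_self)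
  qed (unfold max_jump.simps IH J, simp_all)
qed (simp add: ray_index_def pole_order_def)

lemma pole_order_ray_index_ge:
  assumes "p > 0" "j > 0" "l < n"
  shows "pole_order (ray_index p n m j) l \<ge> max_jump (int p) (pole_order (ray_index p n m j)) l - 1"
proof -
  have "p ^ k * j \<ge> 1" for k using assms by simp
  then show ?thesis
    unfolding max_jump_ray_index[OF assms] using assms by (auto simp: ray_index_def pole_order_def of_nat_diff)
qed

lemma inj_ray_index:
  assumes "m < n"
  shows "inj (ray_index p n m)"
proof (rule injI)
  fix i j assume "ray_index p n m i = ray_index p n m j"
  then have "ray_index p n m i ! m = ray_index p n m j ! m" by simp
  then show "i = j" using assms by (simp add: ray_index_def)
qed

lemma sum_jumps_ray_index:
  fixes g :: "nat \<Rightarrow> real"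
  assumes "p > 0" "j > 0" "m < n"
  shows "(\<Sum>l<n. real_of_int (max_jump (int p) (pole_order (ray_index p n m j)) l) * g l) =
    real j * (\<Sum>l=m..n-1. real p ^ (l - m) * g l)"
proof -
  have "(\<Sum>l<n. real_of_int (max_jump (int p) (pole_order (ray_index p n m j)) l) * g l) =
      (\<Sum>l<n. if l < m then 0 else real j * (real p ^ (l - m) * g l))"
    using assms by (intro sum.cong) (auto simp: max_jump_ray_index)
  also have "\<dots> = (\<Sum>l=m..n-1. real j * (real p ^ (l - m) * g l))"
    using assms by (intro sum.mono_neutral_cong_right) auto
  finally show ?thesis by (simp add: sum_distrib_left)
qed

lemma finite_bounded_strata:
  "finite {js. length js = n \<and> (\<forall>m<n. pole_order js m \<le> B)}"
proof (rule finite_subset)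
  show "finite {js. set js \<subseteq> insert None (Some ` {..nat B}) \<and> length js = n}"
    by (rule finite_lists_length_eq) simp
  show "{js. length js = n \<and> (\<forall>m<n. pole_order js m \<le> B)} \<subseteq>
      {js. set js \<subseteq> insert None (Some ` {..nat B}) \<and> length js = n}"
  proof safe
    fix js x assume "\<forall>m<length js. pole_order js m \<le> B" "x \<in> set js" "x \<notin> Some ` {..nat B}"
    then obtain m where m: "m < length js" "x = js ! m" by (metis in_set_conv_nth)
    then have "pole_order js m \<le> B" using \<open>\<forall>m<length js. pole_order js m \<le> B\<close> by blast
    then show "x = None"
      using m \<open>x \<notin> Some ` {..nat B}\<close> by (cases x) (auto simp: pole_order_def)
  qed
qed

section \<open>The convergence criterion and the bound on the terms\<close>

theorem theorem4p1:
  fixes p n :: nat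
    and scale :: "'k::alg_closed_field \<Rightarrow> 'v::ab_group_add \<Rightarrow> 'v"
    and Basis :: "'v set"
    and \<rho> :: "int \<Rightarrow> 'v \<Rightarrow> 'v"
  assumes "CHAR('k) = p" and "p > 0" and "n \<ge> 1"
    and "finite_dimensional_vector_space scale Basis"
    and "cyclic_rep (p ^ n) scale \<rho>"
    and "effective_rep (p ^ n) \<rho>"
  shows "(integral_converges p n scale \<rho> \<longleftrightarrow>
            (\<forall>m<n. 1 - 1 / real p ^ (n - m)
                     - (\<Sum>l=m..n-1. D_inv p n scale \<rho> l / real p ^ (2 * n - 1 - l)) < 0)) \<and>
         ((\<forall>m<n. 1 - 1 / real p ^ (n - m)
                   - (\<Sum>l=m..n-1. D_inv p n scale \<rho> l / real p ^ (2 * n - 1 - l)) \<le> 0) \<longrightarrow>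
            integral_terms_bounded p n scale \<rho>)"
proof -
  have p: "prime p" using assms(1,2) prime_CHAR_semidom[where ?'a = 'k] by simp
  have p1: "p > 1" using p by (rule prime_gt_1_nat)
  define D where "D = D_inv p n scale \<rho>"
  define dims where "dims = indecomposable_dims (p ^ n) scale \<rho>"
  define \<delta> where "\<delta> = real (vector_space.dim scale (UNIV :: 'v set))"
  \<comment> \<open>\<open>K\<close> bounds the total rounding error of the ceilings.\<close>
  define K where "K = real (\<Sum>d\<in>#dims. card (digit_tuples p n d))"
  \<comment> \<open>\<open>g l\<close> is the weight of the jump at \<open>l\<close> in the
    approximate dimension when pole orders equal jumps.\<close>
  define g where "g l = (1 - 1 / real p) - D l / real p ^ n" for l
  define u where "u js = max_jump (int p) (pole_order js)" for js
  define cond where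
    "cond m = 1 - 1 / real p ^ (n - m) - (\<Sum>l=m..n-1. D l / real p ^ (2 * n - 1 - l))" for m
  \<comment> \<open>\<open>c m\<close> is the value of this linear form on the \<open>m\<close>-th
    ray.\<close>
  define c where "c m = (\<Sum>l=m..n-1. real p ^ (l - m) * g l)" for m
  have c: "c m = real p ^ (n - 1 - m) * cond m" if "m < n" for m
    unfolding c_def g_def cond_def by (rule sum_excess_coefficient[OF p1 that])
  have v: "(\<Sum>l<n. real_of_int (u js l) * D l) / real p ^ n \<le> real_of_int (v_fun p n scale \<rho> E)"
      "real_of_int (v_fun p n scale \<rho> E) \<le> (\<Sum>l<n. real_of_int (u js l) * D l) / real p ^ n + K"
    if "js \<in> strata_indices p n" "E \<in> GCov_stratum p js" for js and E :: "'k fls list"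
    unfolding v_fun_eq[OF assms(4,5) p assms(1) that] K_def D_def D_inv_def dims_def u_def
    by (rule sum_mset_v_jumps_bounds[OF assms(2)])+
  have dim: "real_of_int (term_dim p n scale \<rho> js E) =
      real_of_int (stratum_dim p js) + \<delta> - real_of_int (v_fun p n scale \<rho> E)" for js E
    unfolding term_dim_def \<delta>_def by simp
  have g_sum: "(\<Sum>l<n. real_of_int (u js l) * g l) =
      (1 - 1 / real p) * (\<Sum>l<n. real_of_int (u js l)) - (\<Sum>l<n. real_of_int (u js l) * D l) / real p ^ n"
    for js unfolding g_def
    by (simp add: right_diff_distrib sum_subtractf sum_distrib_left sum_divide_distrib mult_ac)
  have p_frac: "0 \<le> 1 - 1 / real p" "1 - 1 / real p \<le> 1" using p1 by auto
  define w where "w js m = real_of_int (jump_excess (int p) (u js) m)" for js m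
  have w: "w js m \<ge> 0" for js m
    unfolding w_def u_def by (simp add: jump_excess_max_jump_nonneg)
  have upper: "real_of_int (term_dim p n scale \<rho> js E) \<le> (\<Sum>m<n. w js m * c m) + real n + \<delta>"
    if js: "js \<in> strata_indices p n" and E: "E \<in> GCov_stratum p js" for js and E :: "'k fls list"
  proof -
    have "length js = n" using js unfolding strata_indices_def by simp
    then have "real_of_int (stratum_dim p js) \<le>
        (1 - 1 / real p) * (\<Sum>m<n. real_of_int (pole_order js m)) + real n"
      using assms(2) by (rule stratum_dim_bounds)
    \<comment> \<open>Passing from pole orders to jumps can only raise the bound, as
      \<open>1 - 1 / p \<ge> 0\<close>.\<close>
    also have "\<dots> \<le> (1 - 1 / real p) * (\<Sum>m<n. real_of_int (u js m)) + real n"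
      unfolding u_def using p_frac by (intro add_mono mult_left_mono sum_mono) (auto simp: le_max_jump)
    finally have "real_of_int (term_dim p n scale \<rho> js E) \<le>
        (\<Sum>l<n. real_of_int (u js l) * g l) + real n + \<delta>"
      unfolding dim g_sum using v(1)[OF js E] by simp
    also have "(\<Sum>l<n. real_of_int (u js l) * g l) = (\<Sum>m<n. w js m * c m)"
      using sum_jumps_eq_sum_excess[where P = "int p" and u = "u js" and g = g and n = n]
      by (simp add: w_def c_def)
    finally show ?thesis .
  qed
  have bounded: "integral_terms_bounded p n scale \<rho>" if "\<forall>m<n. cond m \<le> 0"
    unfolding integral_terms_bounded_def
  proof (intro exI ballI)
    fix js and E :: "'k fls list"
    assume jsE: "js \<in> strata_indices p n" "E \<in> GCov_stratum p js"
    have "(\<Sum>m<n. w js m * c m) \<le> 0"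
      using that w by (intro sum_nonpos) (simp add: c mult_nonneg_nonpos)
    then have "real_of_int (term_dim p n scale \<rho> js E) \<le> real n + \<delta>" using upper[OF jsE] by simp
    then show "term_dim p n scale \<rho> js E \<le> \<lfloor>real n + \<delta>\<rfloor>" by (subst le_floor_iff)
  qed
  have convergent: "integral_converges p n scale \<rho>" if neg: "\<forall>m<n. cond m < 0"
    unfolding integral_converges_def
  proof
    fix N :: int
    \<comment> \<open>The slowest decay along a ray; it is positive because there are finitely many
      rays, and at least one.\<close>
    define \<epsilon> where "\<epsilon> = Min ((\<lambda>m. - c m) ` {..<n})"
    have "0 \<in> {..<n}" using assms(3) by simp
    then have ne: "{..<n} \<noteq> {}" by blast
    have "- c m > 0" if "m < n" for m
      using neg that p1 by (simp add: c mult_pos_neg)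
    then have \<epsilon>: "\<epsilon> > 0" unfolding \<epsilon>_def using ne by (subst Min_gr_iff) auto
    have c_le: "c m \<le> - \<epsilon>" if "m < n" for m
    proof -
      have "\<epsilon> \<le> - c m" unfolding \<epsilon>_def using that by (intro Min_le) auto
      then show ?thesis by simp
    qed
    \<comment> \<open>A term above \<open>N\<close> has ray coordinates of total at most
      \<open>(n + \<delta> - N) / \<epsilon>\<close>, and every jump is at most \<open>p ^ n\<close>
      times this total.\<close>
    define B where "B = \<lceil>real p ^ n * ((real n + \<delta> - real_of_int N) / \<epsilon>)\<rceil>"
    have "pole_order js l \<le> B"
      if js: "js \<in> strata_indices p n" and E: "E \<in> GCov_stratum p js"
        and N: "term_dim p n scale \<rho> js E > N" and l: "l < n" for js l and E :: "'k fls list"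
    proof -
      have "(\<Sum>m<n. w js m * c m) \<le> (\<Sum>m<n. w js m * (- \<epsilon>))"
        using w c_le by (intro sum_mono mult_left_mono) auto
      also have "\<dots> = - \<epsilon> * (\<Sum>m<n. w js m)" by (simp add: sum_distrib_left mult.commute sum_negf)
      finally have "real_of_int N \<le> - \<epsilon> * (\<Sum>m<n. w js m) + real n + \<delta>"
        using upper[OF js E] N by linarith
      then have W: "(\<Sum>m<n. w js m) \<le> (real n + \<delta> - real_of_int N) / \<epsilon>"
        using \<epsilon> by (simp add: field_simps)
      have "real_of_int (pole_order js l) \<le> real_of_int (u js l)"
        unfolding u_def by (simp add: le_max_jump)
      also have "\<dots> = (\<Sum>m\<le>l. real p ^ (l - m) * w js m)"
        unfolding w_def by (subst jump_eq_sum_excess[of _ _ "int p"]) simp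
      also have "\<dots> \<le> (\<Sum>m\<le>l. real p ^ n * w js m)"
        using w p1 l by (intro sum_mono mult_right_mono power_increasing) auto
      also have "\<dots> \<le> (\<Sum>m<n. real p ^ n * w js m)"
        using w l by (intro sum_mono2) auto
      also have "\<dots> \<le> real p ^ n * ((real n + \<delta> - real_of_int N) / \<epsilon>)"
        unfolding sum_distrib_left[symmetric] by (intro mult_left_mono W) simp
      also have "\<dots> \<le> real_of_int B" unfolding B_def by (rule le_of_int_ceiling)
      finally show ?thesis by simp
    qed
    then have "{js \<in> strata_indices p n. \<exists>E\<in>GCov_stratum p js. term_dim p n scale \<rho> js E > N} \<subseteq>
        {js. length js = n \<and> (\<forall>m<n. pole_order js m \<le> B)}"
      unfolding strata_indices_def by blast
    then show "finite {js \<in> strata_indices p n. \<exists>E\<in>GCov_stratum p js. term_dim p n scale \<rho> js E > N}"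
      using finite_bounded_strata finite_subset by blast
  qed
  have "\<not> integral_converges p n scale \<rho>" if m: "m < n" "cond m \<ge> 0" for m
  proof
    \<comment> \<open>Along a ray with \<open>c m \<ge> 0\<close> all terms have dimension at least
      \<open>\<delta> - n - K\<close>; \<open>N\<close> lies strictly below.\<close>
    define N where "N = \<lfloor>\<delta> - real n - K\<rfloor> - 1"
    assume "integral_converges p n scale \<rho>"
    then have fin: "finite {js \<in> strata_indices p n.
        \<exists>E\<in>GCov_stratum p js. term_dim p n scale \<rho> js E > N}"
      unfolding integral_converges_def by blast
    have "ray_index p n m j \<in> {js \<in> strata_indices p n.
        \<exists>E\<in>GCov_stratum p js. term_dim p n scale \<rho> js E > N}" if j: "\<not> p dvd j" for j
    proof -
      let ?js = "ray_index p n m j"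
      have j0: "j > 0" using j by (intro Nat.gr0I) auto
      have js: "?js \<in> strata_indices p n" by (rule ray_index_in_strata[OF p1 j])
      then have len: "length ?js = n" unfolding strata_indices_def by simp
      obtain E :: "'k fls list" where E: "E \<in> GCov_stratum p ?js"
        using GCov_stratum_nonempty[OF js] by blast
      have "(\<Sum>l<n. real_of_int (u ?js l) * g l) = real j * c m"
        unfolding u_def c_def by (rule sum_jumps_ray_index[OF assms(2) j0 m(1)])
      also have "\<dots> \<ge> 0" using c[OF m(1)] m(2) by simp
      finally have nonneg: "(\<Sum>l<n. real_of_int (u ?js l) * g l) \<ge> 0" .
      \<comment> \<open>Each pole order falls short of its jump by at most 1, a loss of at most
        \<open>n\<close> in total.\<close>
      have "(\<Sum>l<n. real_of_int (u ?js l)) - real n = (\<Sum>l<n. real_of_int (u ?js l - 1))"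
        by (simp add: sum_subtractf)
      also have "\<dots> \<le> (\<Sum>l<n. real_of_int (pole_order ?js l))"
        unfolding u_def
        by (intro sum_mono of_int_le_iff[THEN iffD2] pole_order_ray_index_ge assms(2) j0) simp
      finally have "(1 - 1 / real p) * ((\<Sum>l<n. real_of_int (u ?js l)) - real n) \<le>
          (1 - 1 / real p) * (\<Sum>l<n. real_of_int (pole_order ?js l))"
        using p_frac by (intro mult_left_mono)
      also have "\<dots> \<le> real_of_int (stratum_dim p ?js)"
        by (rule stratum_dim_bounds[OF len assms(2)])
      finally have "(1 - 1 / real p) * (\<Sum>l<n. real_of_int (u ?js l)) \<le>
          real_of_int (stratum_dim p ?js) + (1 - 1 / real p) * real n"
        by (simp add: right_diff_distrib)
      also have "(1 - 1 / real p) * real n \<le> real n"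
        using p_frac mult_right_mono[of "1 - 1 / real p" 1 "real n"] by simp
      finally have "real_of_int (term_dim p n scale \<rho> ?js E) \<ge> \<delta> - real n - K"
        using nonneg v(2)[OF js E] unfolding dim g_sum by simp
      then have "term_dim p n scale \<rho> ?js E > N" unfolding N_def by linarith
      then show ?thesis using js E by blast
    qed
    then have "ray_index p n m ` {j. \<not> p dvd j} \<subseteq> {js \<in> strata_indices p n.
        \<exists>E\<in>GCov_stratum p js. term_dim p n scale \<rho> js E > N}" by blast
    then have "finite (ray_index p n m ` {j. \<not> p dvd j})" using fin by (rule finite_subset)
    then have "finite {j. \<not> p dvd j}"
      using inj_on_subset[OF inj_ray_index[OF m(1)]] by (simp add: finite_image_iff)
    \<comment> \<open>The numbers \<open>p * t + 1\<close> supply infinitely many indices prime to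
      \<open>p\<close>.\<close>
    moreover have "range (\<lambda>t. p * t + 1) \<subseteq> {j. \<not> p dvd j}"
      using p1 dvd_add_right_iff[of p "p * _" 1] by auto
    moreover have "inj (\<lambda>t. p * t + 1)" using p1 by (auto intro: injI)
    ultimately show False
      using finite_subset finite_imageD infinite_UNIV_nat by blast
  qed
  then have "integral_converges p n scale \<rho> \<longleftrightarrow> (\<forall>m<n. cond m < 0)"
    using convergent by (meson not_le)
  then show ?thesis using bounded unfolding cond_def D_def by blast
qed

end
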